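(* Assume that $\mathfrak{c}=\omega_2$, $\mathrm{non}(\mathcal{N})=\omega_1$ and $\mathrm{cov}(\mathcal{N}_{\omega_2})=\mathfrak{c}$. If $K$ is a compact space supporting a measure and $\pi\chi(K)\leq\omega_1$, then $K$ is separable.
   Context: $\mathfrak{c}=2^{\aleph_0}$. For a cardinal $\kappa$, $\lambda_\kappa$ is the standard product probability measure on $2^\kappa$ (product of the uniform measures on $\{0,1\}$; all Borel sets are measurable for its completion), and $\mathcal{N}_\kappa$ is the ideal of $\lambda_\kappa$-null subsets of $2^\kappa$; $\mathcal{N}=\mathcal{N}_\omega$. For an ideal $\mathcal{I}$ on a set $S$: $\mathrm{non}(\mathcal{I})=\min\{|X|\colon X\subseteq S,\ X\notin\mathcal{I}\}$ and $\mathrm{cov}(\mathcal{I})=\min\{|\mathcal{A}|\colon \mathcal{A}\subseteq\mathcal{I},\ \bigcup\mathcal{A}=S\}$. Compact spaces are Hausdorff. A measure on a topological space is a finite Borel measure that is Radon, i.e. inner regular with respect to compact sets. A space $K$ supports a measure if there is a measure $\mu$ on $K$ with $\mu(U)>0$ for every nonempty open $U\subseteq K$. For $x\in K$, a family $\mathcal{P}$ of nonempty open sets is a $\pi$-base at $x$ if for every open $V\ni x$ there is $U\in\mathcal{P}$ with $U\subseteq V$; $\pi(x,K)$ is the least cardinality of a $\pi$-base at $x$, and $\pi\chi(K)=\sup\{\pi(x,K)\colon x\in K\}$. *)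

theory Defs
  imports "HOL-Probability.Probability"
begin

unbundle cardinal_syntax

abbreviation omega1 :: "nat set rel" ("\<omega>\<^sub>1") where
  "\<omega>\<^sub>1 \<equiv> cardSuc natLeq"

abbreviation omega2 :: "nat set set rel" ("\<omega>\<^sub>2") where
  "\<omega>\<^sub>2 \<equiv> cardSuc \<omega>\<^sub>1"

abbreviation continuum :: "(nat \<Rightarrow> bool) rel" ("\<cc>") where
  "\<cc> \<equiv> ctwo ^c natLeq"

text \<open>The least cardinality of a member of a family of sets. It is meaningful only
  if the family is nonempty, which is the case wherever it is used below. Cardinals are
  compared up to order isomorphism, with \<open>=o\<close> and \<open>\<le>o\<close>.\<close>

definition min_card :: "'a set set \<Rightarrow> 'a rel" where
  "min_card F = |SOME A. A \<in> F \<and> (\<forall>B\<in>F. |A| \<le>o |B| )|"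

lemma min_card_attained_least:
  assumes "F \<noteq> {}"
  shows "(\<exists>A\<in>F. min_card F = |A| ) \<and> (\<forall>B\<in>F. min_card F \<le>o |B| )"
proof -
  have "\<exists>r\<in>card_of ` F. \<forall>r'\<in>card_of ` F. r \<le>o r'"
    using assms by (intro exists_minim_Card_order) (auto simp: card_of_Card_order)
  then have "\<exists>A. A \<in> F \<and> (\<forall>B\<in>F. |A| \<le>o |B| )" by auto
  from someI_ex[OF this] show ?thesis unfolding min_card_def by auto
qed


text \<open>For a cardinal \<open>\<kappa>\<close>, the power \<open>2\<^sup>\<kappa>\<close> is the set of (extensional) boolean functions
  on \<open>Field \<kappa>\<close>. The completion of the product measure also measures the Borel sets of
  \<open>2\<^sup>\<kappa>\<close>, so its null sets are exactly the \<open>\<lambda>\<^sub>\<kappa>\<close>-null sets.\<close>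

definition cantor_measure :: "'i rel \<Rightarrow> ('i \<Rightarrow> bool) measure" where
  "cantor_measure \<kappa> = Pi\<^sub>M (Field \<kappa>) (\<lambda>_. uniform_count_measure UNIV)"

definition null_ideal :: "'i rel \<Rightarrow> ('i \<Rightarrow> bool) set set" where
  "null_ideal \<kappa> = null_sets (completion (cantor_measure \<kappa>))"

definition non_ideal :: "'a set \<Rightarrow> 'a set set \<Rightarrow> 'a rel" where
  "non_ideal S I = min_card {X. X \<subseteq> S \<and> X \<notin> I}"

definition cov_ideal :: "'a set \<Rightarrow> 'a set set \<Rightarrow> 'a set rel" where
  "cov_ideal S I = min_card {A. A \<subseteq> I \<and> \<Union>A = S}"

abbreviation non_null :: "'i rel \<Rightarrow> ('i \<Rightarrow> bool) rel" where
  "non_null \<kappa> \<equiv> non_ideal (space (cantor_measure \<kappa>)) (null_ideal \<kappa>)"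

abbreviation cov_null :: "'i rel \<Rightarrow> ('i \<Rightarrow> bool) set rel" where
  "cov_null \<kappa> \<equiv> cov_ideal (space (cantor_measure \<kappa>)) (null_ideal \<kappa>)"


definition radon_measure_on :: "'a topology \<Rightarrow> 'a measure \<Rightarrow> bool" where
  "radon_measure_on K \<mu> \<longleftrightarrow>
     space \<mu> = topspace K \<and>
     sets \<mu> = sigma_sets (topspace K) {U. openin K U} \<and>
     finite_measure \<mu> \<and>
     (\<forall>A\<in>sets \<mu>. emeasure \<mu> A = (SUP C\<in>{C. compactin K C \<and> C \<subseteq> A}. emeasure \<mu> C))"

definition supports_measure :: "'a topology \<Rightarrow> bool" where
  "supports_measure K \<longleftrightarrow>
     (\<exists>\<mu>. radon_measure_on K \<mu> \<and> (\<forall>U. openin K U \<and> U \<noteq> {} \<longrightarrow> emeasure \<mu> U > 0))"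


definition pi_base_at :: "'a topology \<Rightarrow> 'a \<Rightarrow> 'a set set \<Rightarrow> bool" where
  "pi_base_at K x P \<longleftrightarrow>
     (\<forall>U\<in>P. openin K U \<and> U \<noteq> {}) \<and>
     (\<forall>V. openin K V \<and> x \<in> V \<longrightarrow> (\<exists>U\<in>P. U \<subseteq> V))"

definition pi_char_at :: "'a topology \<Rightarrow> 'a \<Rightarrow> 'a set rel" where
  "pi_char_at K x = min_card {P. pi_base_at K x P}"

text \<open>The supremum of the cardinals \<open>pi_char_at K x\<close>, i.e. their least cardinal upper
  bound. All of them are cardinalities of sets of type \<^typ>\<open>'a set set\<close>, so the least upper
  bound is attained at such a set too.\<close>

definition pi_character :: "'a topology \<Rightarrow> 'a set rel" where
  "pi_character K = min_card {B. \<forall>x\<in>topspace K. pi_char_at K x \<le>o |B| }"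

lemma pi_character_le_iff:
  fixes K :: "'a topology" and \<kappa> :: "'b rel"
  assumes "Card_order \<kappa>"
  shows "pi_character K \<le>o \<kappa> \<longleftrightarrow> (\<forall>x\<in>topspace K. pi_char_at K x \<le>o \<kappa>)"
proof -
  let ?F = "{B :: 'a set set. \<forall>x\<in>topspace K. pi_char_at K x \<le>o |B| }"
  have "UNIV \<in> ?F"
    by (auto simp: pi_char_at_def min_card_def intro: card_of_mono1)
  then have ne: "?F \<noteq> {}" by blast
  note m = min_card_attained_least[OF ne, folded pi_character_def]
  show ?thesis
  proof
    assume "pi_character K \<le>o \<kappa>"
    then show "\<forall>x\<in>topspace K. pi_char_at K x \<le>o \<kappa>"
      using m ordLeq_transitive by fastforce
  next
    assume *: "\<forall>x\<in>topspace K. pi_char_at K x \<le>o \<kappa>"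
    show "pi_character K \<le>o \<kappa>"
    proof (cases "\<kappa> \<le>o |UNIV :: 'a set set|")
      case True
      then obtain B :: "'a set set" where B: "|B| =o \<kappa>"
        using internalize_card_of_ordLeq2[of "Field \<kappa>" "UNIV :: 'a set set"]
          card_of_Field_ordIso[OF assms] ordIso_symmetric ordIso_transitive ordIso_ordLeq_trans
        by metis
      then have "B \<in> ?F" using * ordIso_symmetric ordLeq_ordIso_trans by fast
      then show ?thesis using m B ordLeq_ordIso_trans by blast
    next
      case False
      then have "|UNIV :: 'a set set| \<le>o \<kappa>"
        using assms card_of_Well_order ordLeq_total card_order_on_well_order_on by blast
      moreover have "pi_character K \<le>o |UNIV :: 'a set set|"
        using m \<open>UNIV \<in> ?F\<close> by blast
      ultimately show ?thesis using ordLeq_transitive by blast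
    qed
  qed
qed

end

(*
  Suppose K is not separable, with strictly positive measure mu. Since pi-chi(K) <= c and K is ccc,
  K has a dense set {d_a : a < omega_2}. The closures E_a of {d_b : b < a} increase.

  Because cov(N_{omega_2}) > omega_1, any omega_1 nonempty open sets are hit by a countable set:
  choose compact subsets of positive measure, realise their joint law on a power of 2, and take a
  random sequence avoiding omega_1 null sets. With pi-chi(K) <= omega_1 this shows that no set of
  size omega_1 is dense, so each complement of E_a contains a closed set H_a of positive measure.

  Because non(N) = omega_1, cofinally many of the H_a have the finite intersection property:
  the measurable envelope of H_a in the algebra of its predecessors depends on countably many of
  them, by pressing down these countable sets may be taken inside one countable set, and then
  the envelopes are sorted into omega_1 classes by common density points. A point common to
  these H_a lies outside all E_a, but each member of a pi-base of size omega_1 at it contains some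
  d_b, and boundedness of the indices b puts it into some E_a.
*)
theory Submission
  imports Defs "HOL-Library.Countable_Set_Type"
begin

subsection \<open>Independent blocks of a product measure\<close>

text \<open>Every thinning of the \<open>\<omega>\<^sub>2\<close> indices is a pigeonhole argument,
  so it may use at most \<open>\<omega>\<^sub>1\<close> classes. This is the obstacle: since
  \<open>\<omega>\<^sub>2\<close> is the continuum, an ordinal of size
  \<open>\<omega>\<^sub>1\<close> has as many countable subsets as there are indices, and a
  countably generated algebra can have that many events. The first excess is removed by writing such
  an ordinal as an increasing union of \<open>\<omega>\<^sub>1\<close> countable sets, the second by
  letting a non-null set of size \<open>\<omega>\<^sub>1\<close> supply the density points. The
  measure on K can be of any Maharam type, but the sampling argument only sees the joint law of
  \<open>\<omega>\<^sub>1\<close> events. Countably many independent samples of that law use only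
  \<open>\<omega>\<^sub>1\<close> coins, so they fit into the power of 2 whose covering number is
  assumed. Samples are patterns of membership, not points of K; the events are closed sets, so that
  compactness turns a pattern whose finite parts have positive measure into a point. A density bound
  for K is not given in advance. It comes from closing off under a countable exhaustion argument, at
  the cost of naming points by continuum many trees.\<close>

lemma indep_vars_PiM_coordinates:
  assumes "\<And>j. j \<in> J \<Longrightarrow> prob_space (N j)" "J \<noteq> {}"
  shows "prob_space.indep_vars (PiM J N) N (\<lambda>j b. b j) J"
proof -
  interpret prob_space "PiM J N" by (intro prob_space_PiM assms)
  have "distr (PiM J N) (PiM J N) (\<lambda>b. \<lambda>j\<in>J. b j) = distr (PiM J N) (PiM J N) (\<lambda>b. b)"
    by (intro distr_cong) (auto simp: space_PiM PiE_restrict)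
  also have "\<dots> = PiM J N" by (rule distr_id)
  also have "\<dots> = PiM J (\<lambda>j. distr (PiM J N) (N j) (\<lambda>b. b j))"
    by (intro PiM_cong refl distr_PiM_component[symmetric] assms)
  finally show ?thesis
    by (subst indep_vars_iff_distr_eq_PiM') (use assms in auto)
qed

lemma distr_PiM_blocks:
  fixes e :: "'l \<times> 's \<Rightarrow> 'j"
  assumes N: "prob_space N" and e: "inj_on e (L \<times> S)" "e ` (L \<times> S) \<subseteq> J"
    and L: "L \<noteq> {}" "S \<noteq> {}"
    and X[measurable]: "X \<in> measurable (PiM S (\<lambda>_. N)) N'"
  shows "distr (PiM J (\<lambda>_. N)) (PiM L (\<lambda>_. N')) (\<lambda>b. \<lambda>l\<in>L. X (\<lambda>s\<in>S. b (e (l, s))))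
    = PiM L (\<lambda>_. distr (PiM S (\<lambda>_. N)) N' X)"
proof -
  interpret J: prob_space "PiM J (\<lambda>_. N)" by (intro prob_space_PiM N)
  define K where "K l = e ` ({l} \<times> S)" for l
  have Kmem: "e (l, s) \<in> K l" if "s \<in> S" for l s using that by (auto simp: K_def)
  have KJ: "K l \<subseteq> J" if "l \<in> L" for l using e that by (auto simp: K_def)
  have eJ: "e (l, s) \<in> J" if "l \<in> L" "s \<in> S" for l s using e that by auto
  have bm: "(\<lambda>b. \<lambda>s\<in>S. b (e (l, s))) \<in> measurable (PiM J (\<lambda>_. N)) (PiM S (\<lambda>_. N))" if "l \<in> L" for l
    using eJ that by (intro measurable_restrict measurable_component_singleton) auto
  have ind: "J.indep_vars (\<lambda>_. N') (\<lambda>l b. X (\<lambda>s\<in>S. b (e (l, s)))) L"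
  proof -
    have "J.indep_vars (\<lambda>l. PiM (K l) (\<lambda>_. N)) (\<lambda>l b. restrict (\<lambda>j. b j) (K l)) L"
    proof (rule J.indep_vars_restrict)
      show "J.indep_vars (\<lambda>_. N) (\<lambda>j b. b j) J"
        by (intro indep_vars_PiM_coordinates N) (use e L in auto)
      show "disjoint_family_on K L"
        using e(1) by (auto simp: disjoint_family_on_def K_def inj_on_def)
    qed (use KJ in auto)
    then have "J.indep_vars (\<lambda>_. N') (\<lambda>l b. X (\<lambda>s\<in>S. restrict (\<lambda>j. b j) (K l) (e (l, s)))) L"
      by (rule J.indep_vars_compose2)
        (intro measurable_compose[OF _ X] measurable_restrict measurable_component_singleton Kmem)
    then show ?thesis by (simp add: Kmem cong: restrict_cong)
  qed
  have "distr (PiM J (\<lambda>_. N)) (PiM L (\<lambda>_. N')) (\<lambda>b. \<lambda>l\<in>L. X (\<lambda>s\<in>S. b (e (l, s))))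
    = PiM L (\<lambda>l. distr (PiM J (\<lambda>_. N)) N' (\<lambda>b. X (\<lambda>s\<in>S. b (e (l, s)))))"
    using ind by (subst (asm) J.indep_vars_iff_distr_eq_PiM'[OF L(1)]) (use bm X in \<open>auto intro: measurable_compose\<close>)
  also have "\<dots> = PiM L (\<lambda>_. distr (PiM S (\<lambda>_. N)) N' X)"
  proof (rule PiM_cong[OF refl])
    fix l assume l: "l \<in> L"
    have "distr (PiM J (\<lambda>_. N)) (PiM S (\<lambda>_. N)) (\<lambda>b. \<lambda>s\<in>S. b (e (l, s))) = PiM S (\<lambda>_. N)"
      using e l by (intro distr_PiM_reindex[where f="\<lambda>s. e (l, s)"] N) (auto simp: inj_on_def)
    moreover have "distr (PiM J (\<lambda>_. N)) N' (\<lambda>b. X (\<lambda>s\<in>S. b (e (l, s))))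
       = distr (distr (PiM J (\<lambda>_. N)) (PiM S (\<lambda>_. N)) (\<lambda>b. \<lambda>s\<in>S. b (e (l, s)))) N' X"
      using bm[OF l] by (subst distr_distr) (auto simp: comp_def)
    ultimately show "distr (PiM J (\<lambda>_. N)) N' (\<lambda>b. X (\<lambda>s\<in>S. b (e (l, s)))) = distr (PiM S (\<lambda>_. N)) N' X"
      by simp
  qed
  finally show ?thesis .
qed

section \<open>Binary expansion turns fair coins into a uniform real\<close>

abbreviation coin :: "bool measure" where
  "coin \<equiv> uniform_count_measure UNIV"

abbreviation coins :: "'i set \<Rightarrow> ('i \<Rightarrow> bool) measure" where
  "coins J \<equiv> PiM J (\<lambda>_. coin)"

abbreviation unit_measure :: "real measure" where
  "unit_measure \<equiv> uniform_measure lborel {0..1}"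

definition binary_value :: "(nat \<Rightarrow> bool) \<Rightarrow> real" where
  "binary_value b = (\<Sum>n. of_bool (b n) * (1/2) ^ Suc n)"

lemma prob_space_coin: "prob_space coin"
  by (rule prob_space_uniform_count_measure) auto

lemma prob_space_coins: "prob_space (coins J)"
  by (intro prob_space_PiM prob_space_coin)

lemma prob_space_unit_measure: "prob_space unit_measure"
  by (rule prob_space_uniform_measure) auto

lemma space_coins_UNIV [simp]: "space (coins UNIV) = UNIV"
  by (simp add: space_PiM space_uniform_count_measure)

lemma summable_binary: "summable (\<lambda>n. of_bool (b n) * (1/2 :: real) ^ Suc n)"
  by (rule summable_comparison_test'[OF sums_summable[OF power_half_series], of 0]) auto

lemma binary_value_nonneg: "0 \<le> binary_value b"
  unfolding binary_value_def by (intro suminf_nonneg summable_binary) auto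

lemma binary_value_le_1: "binary_value b \<le> 1"
proof -
  have "binary_value b \<le> (\<Sum>n. (1/2) ^ Suc n)"
    unfolding binary_value_def
    by (intro suminf_le summable_binary sums_summable[OF power_half_series]) auto
  also have "\<dots> = 1" using power_half_series by (simp add: sums_iff)
  finally show ?thesis .
qed

lemma measurable_binary_value [measurable]: "binary_value \<in> borel_measurable (coins UNIV)"
  unfolding binary_value_def by measurable

lemma binary_value_case_nat:
  "binary_value (case_nat c b) = (of_bool c + binary_value b) / 2"
proof -
  have "binary_value (case_nat c b) = of_bool c / 2 + (\<Sum>n. of_bool (b n) * (1/2) ^ Suc (Suc n))"
    unfolding binary_value_def
    using suminf_split_head[OF summable_binary, of "case_nat c b"] by simp
  also have "(\<Sum>n. of_bool (b n) * (1/2 :: real) ^ Suc (Suc n)) = binary_value b / 2"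
    unfolding binary_value_def by (subst suminf_divide[OF summable_binary, symmetric]) (simp add: field_simps)
  finally show ?thesis by (simp add: add_divide_distrib)
qed

text \<open>Conditioning on the first coin c: the value is (c + v) / 2, where v is the value of the
  remaining coins and has the same law. It is at most p exactly if v is at most 2p - c.\<close>

lemma cdf_binary_value_self_similar:
  "measure (coins UNIV) {b. binary_value b \<le> p} =
    (measure (coins UNIV) {b. binary_value b \<le> 2 * p} + measure (coins UNIV) {b. binary_value b \<le> 2 * p - 1}) / 2"
proof -
  interpret C: prob_space coin by (rule prob_space_coin)
  interpret sequence_space coin by standard
  have m[measurable]: "{b. binary_value b \<le> q} \<in> sets (coins UNIV)" for q
    using measurable_sets[OF measurable_binary_value, of "{..q}"] by (auto simp: vimage_def)
  let ?A = "{b. binary_value b \<le> p}"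
  have cn: "(\<lambda>(s, \<omega>). case_nat s \<omega>) \<in> measurable (coin \<Otimes>\<^sub>M coins UNIV) (coins UNIV)"
    by measurable
  have "emeasure (coins UNIV) ?A = emeasure (distr (coin \<Otimes>\<^sub>M coins UNIV) (coins UNIV) (\<lambda>(s, \<omega>). case_nat s \<omega>)) ?A"
    by (simp only: PiM_iter)
  also have "\<dots> = emeasure (coin \<Otimes>\<^sub>M coins UNIV) ((\<lambda>(s, \<omega>). case_nat s \<omega>) -` ?A \<inter> space (coin \<Otimes>\<^sub>M coins UNIV))"
    by (rule emeasure_distr[OF cn m])
  also have "\<dots> = (\<integral>\<^sup>+ c. emeasure (coins UNIV) (Pair c -` ((\<lambda>(s, \<omega>). case_nat s \<omega>) -` ?A \<inter> space (coin \<Otimes>\<^sub>M coins UNIV))) \<partial>coin)"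
    by (rule P.emeasure_pair_measure_alt) (rule measurable_sets[OF cn m])
  also have "\<dots> = (\<integral>\<^sup>+ c. emeasure (coins UNIV) {b. binary_value b \<le> 2 * p - of_bool c} \<partial>coin)"
    by (intro nn_integral_cong arg_cong[where f="emeasure (coins UNIV)"])
      (auto simp: space_pair_measure space_uniform_count_measure binary_value_case_nat)
  also have "\<dots> = (\<Sum>c\<in>UNIV. ennreal (1/2) * emeasure (coins UNIV) {b. binary_value b \<le> 2 * p - of_bool c})"
    unfolding uniform_count_measure_def
    by (subst nn_integral_point_measure_finite) (auto simp: card_UNIV_bool)
  also have "\<dots> = ennreal ((measure (coins UNIV) {b. binary_value b \<le> 2 * p} + measure (coins UNIV) {b. binary_value b \<le> 2 * p - 1}) / 2)"
  proof -
    have "(\<Sum>c\<in>UNIV. g c) = g False + g True" for g :: "bool \<Rightarrow> ennreal"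
      by (simp add: UNIV_bool)
    then show ?thesis
      unfolding P.emeasure_eq_measure add_divide_distrib
      by (simp only: ennreal_mult[symmetric] ennreal_plus[symmetric] measure_nonneg)
        (subst ennreal_plus, auto simp: ennreal_mult'[symmetric] divide_ennreal_def algebra_simps simp flip: ennreal_plus ennreal_mult')
  qed
  finally show ?thesis by (simp add: P.emeasure_eq_measure)
qed

lemma cdf_binary_value:
  assumes "0 \<le> p" "p \<le> 1"
  shows "measure (coins UNIV) {b. binary_value b \<le> p} = p"
proof -
  interpret prob_space "coins (UNIV :: nat set)" by (rule prob_space_coins)
  define G where "G p = measure (coins UNIV) {b. binary_value b \<le> p}" for p
  have G1: "G p = 1" if "p \<ge> 1" for p
  proof -
    have "{b. binary_value b \<le> p} = space (coins UNIV)"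
      using order_trans[OF binary_value_le_1 that] by auto
    then show ?thesis using prob_space by (simp add: G_def)
  qed
  have G0: "G p = 0" if "p < 0" for p
  proof -
    have "{b. binary_value b \<le> p} = {}"
      using less_le_trans[OF that binary_value_nonneg] by (auto simp: not_le)
    then show ?thesis by (simp add: G_def)
  qed
  have GG: "G p = (G (2 * p) + G (2 * p - 1)) / 2" for p
    unfolding G_def by (rule cdf_binary_value_self_similar)
  \<comment> \<open>The uniform distribution function solves the same functional equation, and each
    use of the equation halves the distance to it; the start is the trivial bound 1. On either side
    of 1/2 one of the two terms is known exactly, because one of 2p and 2p - 1 has left the unit
    interval or sits at its end.\<close>
  have bound: "\<bar>G p - p\<bar> \<le> (1/2) ^ n" if "0 \<le> p" "p \<le> 1" for n p
    using that
  proof (induction n arbitrary: p)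
    case 0
    have "0 \<le> G p" "G p \<le> 1" by (auto simp: G_def)
    with 0 show ?case by (simp add: abs_if)
  next
    case (Suc n)
    consider "p < 1/2" | "p \<ge> 1/2" by linarith
    then show ?case
    proof cases
      case 1
      have "G p = G (2 * p) / 2" using GG[of p] G0[of "2 * p - 1"] 1 by simp
      then have *: "G p - p = (G (2 * p) - 2 * p) / 2" by simp
      have "\<bar>G p - p\<bar> = \<bar>G (2 * p) - 2 * p\<bar> / 2" unfolding * by simp
      with Suc.IH[of "2 * p"] Suc.prems 1 show ?thesis by simp
    next
      case 2
      have "G p = (1 + G (2 * p - 1)) / 2" using GG[of p] G1[of "2 * p"] 2 by simp
      then have *: "G p - p = (G (2 * p - 1) - (2 * p - 1)) / 2" by (simp add: field_simps)
      have "\<bar>G p - p\<bar> = \<bar>G (2 * p - 1) - (2 * p - 1)\<bar> / 2" unfolding * by simp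
      with Suc.IH[of "2 * p - 1"] Suc.prems 2 show ?thesis by simp
    qed
  qed
  have "(\<lambda>n. (1/2 :: real) ^ n) \<longlonglongrightarrow> 0" by (rule LIMSEQ_power_zero) auto
  then have "\<bar>G p - p\<bar> \<le> 0"
    by (rule LIMSEQ_le_const) (use bound assms in auto)
  then show ?thesis by (simp add: G_def)
qed

lemma distr_binary_value: "distr (coins UNIV) borel binary_value = unit_measure"
proof (rule cdf_unique)
  interpret prob_space "coins (UNIV :: nat set)" by (rule prob_space_coins)
  interpret U: prob_space unit_measure by (rule prob_space_unit_measure)
  show "real_distribution (distr (coins UNIV) borel binary_value)"
    by (rule real_distribution_distr) measurable
  show "real_distribution unit_measure"
    by standard auto
  show "cdf (distr (coins UNIV) borel binary_value) = cdf unit_measure"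
  proof
    fix p
    have sp: "binary_value -` {..p} = {b. binary_value b \<le> p}"
      by auto
    have l: "cdf (distr (coins UNIV) borel binary_value) p = measure (coins UNIV) {b. binary_value b \<le> p}"
      using sp by (simp add: cdf_def measure_distr)
    have r: "cdf unit_measure p = measure lborel ({0..1} \<inter> {..p})"
      by (simp add: cdf_def measure_uniform_measure)
    consider "p < 0" | "0 \<le> p" "p \<le> 1" | "p > 1" by linarith
    then show "cdf (distr (coins UNIV) borel binary_value) p = cdf unit_measure p"
    proof cases
      case 1
      then have "{b. binary_value b \<le> p} = {}"
        using less_le_trans[OF 1 binary_value_nonneg] by (auto simp: not_le)
      moreover have "{0..1} \<inter> {..p} = {}" using 1 by auto
      ultimately show ?thesis using l r by simp
    next
      case 2
      then have "{0..1} \<inter> {..p} = {0..p}" by auto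
      then show ?thesis using l r cdf_binary_value[OF 2] 2 by simp
    next
      case 3
      have "{b. binary_value b \<le> p} = space (coins UNIV)"
        using order_trans[OF binary_value_le_1 less_imp_le[OF 3]] by auto
      moreover have "{0..1} \<inter> {..p} = {0..1}" using 3 by auto
      ultimately show ?thesis using l r prob_space by simp
    qed
  qed
qed

subsection \<open>Families of events realised on a power of 2\<close>

text \<open>Independence of seed i from the seeds in \<open>L\<close>, stated as a product law so
  that Fubini applies to it. The detour through \<open>insert i L\<close> matches the decomposition
  of a product into one coordinate and the rest.\<close>

lemma distr_PiM_component_pair:
  assumes N: "prob_space N" and i: "i \<notin> L" "insert i L \<subseteq> I"
  shows "distr (PiM I (\<lambda>_. N)) (N \<Otimes>\<^sub>M PiM L (\<lambda>_. N)) (\<lambda>t. (t i, restrict t L)) = N \<Otimes>\<^sub>M PiM L (\<lambda>_. N)"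
proof -
  let ?K = "insert i L"
  let ?f = "\<lambda>t. (t i, restrict t L)"
  have f: "?f \<in> measurable (PiM ?K (\<lambda>_. N)) (N \<Otimes>\<^sub>M PiM L (\<lambda>_. N))"
    by (intro measurable_Pair measurable_component_singleton measurable_restrict_subset) auto
  have r: "(\<lambda>t. restrict t ?K) \<in> measurable (PiM I (\<lambda>_. N)) (PiM ?K (\<lambda>_. N))"
    using i by (intro measurable_restrict_subset) auto
  have g: "(\<lambda>(x, X). X(i := x)) \<in> measurable (N \<Otimes>\<^sub>M PiM L (\<lambda>_. N)) (PiM ?K (\<lambda>_. N))"
    by measurable
  have 1: "distr (PiM I (\<lambda>_. N)) (PiM ?K (\<lambda>_. N)) (\<lambda>t. restrict t ?K) = PiM ?K (\<lambda>_. N)"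
    using distr_PiM_reindex[of I "\<lambda>_. N" "\<lambda>x. x" ?K] N i by auto
  have 2: "distr (N \<Otimes>\<^sub>M PiM L (\<lambda>_. N)) (PiM ?K (\<lambda>_. N)) (\<lambda>(x, X). X(i := x)) = PiM ?K (\<lambda>_. N)"
    by (intro distr_pair_PiM_eq_PiM N)
  have "distr (PiM I (\<lambda>_. N)) (N \<Otimes>\<^sub>M PiM L (\<lambda>_. N)) ?f
      = distr (distr (PiM I (\<lambda>_. N)) (PiM ?K (\<lambda>_. N)) (\<lambda>t. restrict t ?K)) (N \<Otimes>\<^sub>M PiM L (\<lambda>_. N)) ?f"
    by (subst distr_distr[OF f r]) (auto intro!: distr_cong simp: comp_def Int_absorb1 Int_absorb2 subset_insertI)
  also have "\<dots> = distr (PiM ?K (\<lambda>_. N)) (N \<Otimes>\<^sub>M PiM L (\<lambda>_. N)) ?f" by (simp only: 1)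
  also have "\<dots> = distr (distr (N \<Otimes>\<^sub>M PiM L (\<lambda>_. N)) (PiM ?K (\<lambda>_. N)) (\<lambda>(x, X). X(i := x))) (N \<Otimes>\<^sub>M PiM L (\<lambda>_. N)) ?f"
    by (simp only: 2)
  also have "\<dots> = distr (N \<Otimes>\<^sub>M PiM L (\<lambda>_. N)) (N \<Otimes>\<^sub>M PiM L (\<lambda>_. N)) (?f \<circ> (\<lambda>(x, X). X(i := x)))"
    by (rule distr_distr[OF f g])
  also have "\<dots> = distr (N \<Otimes>\<^sub>M PiM L (\<lambda>_. N)) (N \<Otimes>\<^sub>M PiM L (\<lambda>_. N)) (\<lambda>x. x)"
  proof (intro distr_cong refl)
    fix x assume x: "x \<in> space (N \<Otimes>\<^sub>M PiM L (\<lambda>_. N))"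
    obtain s w where sw: "x = (s, w)" by (cases x)
    have "w \<in> extensional L" using x by (auto simp: sw space_pair_measure space_PiM PiE_def)
    then have "restrict (w(i := s)) L = w"
      using i by (auto intro!: ext simp: restrict_def extensional_def)
    then show "(?f \<circ> (\<lambda>(x, X). X(i := x))) x = x" by (simp add: sw)
  qed
  finally show ?thesis by (simp add: distr_id)
qed

lemma emeasure_unit_measure_le:
  assumes "c \<le> 1"
  shows "emeasure unit_measure {s. ennreal s \<le> c} = c"
proof -
  obtain r where r: "c = ennreal r" "0 \<le> r" "r \<le> 1"
    using assms by (cases c) (auto simp flip: ennreal_1 simp: top_unique)
  have "{0..1} \<inter> {s. ennreal s \<le> c} = {0..r}"
    using r by (auto simp: ennreal_le_iff)
  moreover have "{s. ennreal s \<le> c} \<in> sets lborel" by measurable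
  ultimately show ?thesis using r by (simp add: divide_ennreal_def)
qed

text \<open>\<open>q\<close> is a version of the conditional probability of \<open>S\<close> given
  \<open>h\<close>: the Radon-Nikodym density, with respect to the law of \<open>h\<close>, of the
  part of that law that comes from \<open>S\<close>. It is bounded by 1 everywhere, not just almost
  everywhere, so that it can serve as a threshold for a uniform seed.\<close>

lemma conditional_probability_density:
  assumes M: "prob_space M" and h[measurable]: "h \<in> measurable M X" and S[measurable]: "S \<in> sets M"
  obtains q where "q \<in> borel_measurable X" "\<And>x. q x \<le> (1::ennreal)"
    "\<And>A. A \<in> sets X \<Longrightarrow> (\<integral>\<^sup>+x. q x * indicator A x \<partial>distr M X h) = emeasure M (h -` A \<inter> S \<inter> space M)"
proof -
  interpret prob_space M by fact
  let ?\<nu> = "distr M X h" and ?\<rho> = "distr (density M (indicator S)) X h"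
  interpret \<nu>: prob_space ?\<nu> by (rule prob_space_distr) fact
  have \<rho>: "emeasure ?\<rho> A = emeasure M (h -` A \<inter> S \<inter> space M)" if A[measurable]: "A \<in> sets X" for A
  proof -
    have "emeasure ?\<rho> A = emeasure (density M (indicator S)) (h -` A \<inter> space M)"
      by (subst emeasure_distr) auto
    also have "\<dots> = (\<integral>\<^sup>+x. indicator (h -` A \<inter> S \<inter> space M) x \<partial>M)"
      by (subst emeasure_density, simp, simp, rule nn_integral_cong) (auto split: split_indicator)
    also have "\<dots> = emeasure M (h -` A \<inter> S \<inter> space M)"
    proof (rule nn_integral_indicator)
      have "(h -` A \<inter> space M) \<inter> S \<in> sets M"
        by (intro sets.Int measurable_sets[OF h A] S)
      then show "h -` A \<inter> S \<inter> space M \<in> sets M" by (simp only: Int_ac)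
    qed
    finally show ?thesis .
  qed
  have le: "emeasure ?\<rho> A \<le> emeasure ?\<nu> A" if A: "A \<in> sets X" for A
    unfolding \<rho>[OF A] using A by (subst emeasure_distr) (auto intro!: emeasure_mono)
  have ac: "absolutely_continuous ?\<nu> ?\<rho>"
    unfolding absolutely_continuous_def
  proof
    fix A assume "A \<in> null_sets ?\<nu>"
    then show "A \<in> null_sets ?\<rho>" using le[of A] by (auto simp: null_sets_def)
  qed
  obtain f where f[measurable]: "f \<in> borel_measurable X" and f\<rho>: "density ?\<nu> f = ?\<rho>"
    using \<nu>.Radon_Nikodym[OF ac] by auto
  have fA: "(\<integral>\<^sup>+x. f x * indicator A x \<partial>?\<nu>) = emeasure M (h -` A \<inter> S \<inter> space M)" if A: "A \<in> sets X" for A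
    using \<rho>[OF A] A by (subst (asm) f\<rho>[symmetric]) (simp add: emeasure_density)
  have "AE x in ?\<nu>. f x \<le> 1"
  proof (rule ccontr)
    assume n: "\<not> ?thesis"
    define A where "A = {x \<in> space X. 1 < f x}"
    have A[measurable]: "A \<in> sets X" unfolding A_def by measurable
    have "(\<integral>\<^sup>+x. indicator A x \<partial>?\<nu>) < (\<integral>\<^sup>+x. f x * indicator A x \<partial>?\<nu>)"
    proof (rule nn_integral_less)
      show "(\<integral>\<^sup>+x. indicator A x \<partial>?\<nu>) \<noteq> \<infinity>" using A by simp
      show "AE x in ?\<nu>. indicator A x \<le> f x * indicator A x"
        by (auto simp: A_def indicator_def less_imp_le)
      show "\<not> (AE x in ?\<nu>. f x * indicator A x \<le> indicator A x)"
      proof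
        assume "AE x in ?\<nu>. f x * indicator A x \<le> indicator A x"
        then have "AE x in ?\<nu>. f x \<le> 1"
          by (rule AE_mp) (auto intro!: AE_I2 simp: A_def indicator_def not_less split: if_splits)
        with n show False by simp
      qed
    qed auto
    also have "\<dots> = emeasure ?\<rho> A" using fA[OF A] \<rho>[OF A] by simp
    also have "\<dots> \<le> emeasure ?\<nu> A" by (rule le) fact
    finally show False using A by simp
  qed
  \<comment> \<open>Cutting off at 1 changes the density on a null set only, so its integrals stay
    the same.\<close>
  then have eq: "AE x in ?\<nu>. min 1 (f x) = f x" by (auto elim: eventually_mono simp: min_def)
  show ?thesis
  proof
    show "(\<lambda>x. min 1 (f x)) \<in> borel_measurable X" by measurable
    show "(\<integral>\<^sup>+x. min 1 (f x) * indicator A x \<partial>?\<nu>) = emeasure M (h -` A \<inter> S \<inter> space M)" if A: "A \<in> sets X" for A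
      unfolding fA[OF A, symmetric] using eq by (intro nn_integral_cong_AE) auto
  qed auto
qed

text \<open>Integrate out the seed \<open>t i\<close> first. It is independent of the seeds in
  \<open>L\<close>, and with these fixed the admissible values of \<open>t i\<close> form an initial
  segment of the unit interval of length \<open>q\<close>.\<close>

lemma emeasure_threshold:
  fixes q :: "('i \<Rightarrow> bool) \<Rightarrow> ennreal"
  assumes i: "i \<notin> L" "insert i L \<subseteq> I"
    and \<Phi>[measurable]: "\<Phi> \<in> measurable (PiM L (\<lambda>_. unit_measure)) X"
    and q[measurable]: "q \<in> borel_measurable X" and q1: "\<And>x. q x \<le> 1" and A[measurable]: "A \<in> sets X"
  shows "emeasure (PiM I (\<lambda>_. unit_measure))
      {t \<in> space (PiM I (\<lambda>_. unit_measure)). \<Phi> (restrict t L) \<in> A \<and> ennreal (t i) \<le> q (\<Phi> (restrict t L))}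
    = (\<integral>\<^sup>+x. q x * indicator A x \<partial>distr (PiM L (\<lambda>_. unit_measure)) X \<Phi>)"
proof -
  let ?U = "\<lambda>_. unit_measure" and ?P = "unit_measure \<Otimes>\<^sub>M PiM L (\<lambda>_. unit_measure)"
  interpret U: prob_space unit_measure by (rule prob_space_unit_measure)
  interpret L: prob_space "PiM L ?U" by (intro prob_space_PiM prob_space_unit_measure)
  interpret pair_sigma_finite unit_measure "PiM L ?U" ..
  define W where "W = {x \<in> space ?P. \<Phi> (snd x) \<in> A \<and> ennreal (fst x) \<le> q (\<Phi> (snd x))}"
  have W[measurable]: "W \<in> sets ?P" unfolding W_def by measurable
  have m: "(\<lambda>t. (t i, restrict t L)) \<in> measurable (PiM I ?U) ?P"
    using i by (intro measurable_Pair measurable_component_singleton measurable_restrict_subset) auto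
  have "emeasure (PiM I ?U) {t \<in> space (PiM I ?U). \<Phi> (restrict t L) \<in> A \<and> ennreal (t i) \<le> q (\<Phi> (restrict t L))}
      = emeasure (PiM I ?U) ((\<lambda>t. (t i, restrict t L)) -` W \<inter> space (PiM I ?U))"
    using measurable_space[OF m] by (intro arg_cong[where f="emeasure _"]) (auto simp: W_def)
  also have "\<dots> = emeasure (distr (PiM I ?U) ?P (\<lambda>t. (t i, restrict t L))) W"
    by (rule emeasure_distr[symmetric, OF m W])
  also have "\<dots> = emeasure ?P W" by (simp only: distr_PiM_component_pair[OF prob_space_unit_measure i])
  also have "\<dots> = (\<integral>\<^sup>+w. emeasure unit_measure ((\<lambda>s. (s, w)) -` W) \<partial>PiM L ?U)"
    by (rule emeasure_pair_measure_alt2) fact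
  also have "\<dots> = (\<integral>\<^sup>+w. q (\<Phi> w) * indicator A (\<Phi> w) \<partial>PiM L ?U)"
  proof (rule nn_integral_cong)
    fix w assume w: "w \<in> space (PiM L ?U)"
    then have "(\<lambda>s. (s, w)) -` W = (if \<Phi> w \<in> A then {s. ennreal s \<le> q (\<Phi> w)} else {})"
      by (auto simp: W_def space_pair_measure)
    then show "emeasure unit_measure ((\<lambda>s. (s, w)) -` W) = q (\<Phi> w) * indicator A (\<Phi> w)"
      using emeasure_unit_measure_le[OF q1] by auto
  qed
  also have "\<dots> = (\<integral>\<^sup>+x. q x * indicator A x \<partial>distr (PiM L ?U) X \<Phi>)"
    by (subst nn_integral_distr) auto
  finally show ?thesis .
qed

text \<open>An arbitrary condition on the truth value \<open>p x\<close> is reduced to the two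
  events \<open>P\<close> and \<open>P\<close> with \<open>p\<close>, whose probabilities are the
  ones known in the recursion for membership decisions.\<close>

lemma (in finite_measure) emeasure_bool_split:
  assumes X: "{x \<in> space M. P x} \<in> sets M" and Y: "{x \<in> space M. P x \<and> p x} \<in> sets M"
  shows "emeasure M {x \<in> space M. P x \<and> p x \<in> E} =
    (if True \<in> E then emeasure M {x \<in> space M. P x \<and> p x} else 0) +
    (if False \<in> E then emeasure M {x \<in> space M. P x} - emeasure M {x \<in> space M. P x \<and> p x} else 0)"
proof -
  let ?X = "{x \<in> space M. P x}" and ?Y = "{x \<in> space M. P x \<and> p x}"
  have d: "emeasure M ?X - emeasure M ?Y = emeasure M (?X - ?Y)"
    by (rule emeasure_Diff[symmetric]) (use X Y in auto)
  have "emeasure M {x \<in> space M. P x \<and> p x \<in> E} = emeasure M ((if True \<in> E then ?Y else {}) \<union> (if False \<in> E then ?X - ?Y else {}))"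
  proof -
    have "p x \<in> E \<longleftrightarrow> (if p x then True \<in> E else False \<in> E)" for x by (cases "p x") auto
    then have "{x \<in> space M. P x \<and> p x \<in> E} = (if True \<in> E then ?Y else {}) \<union> (if False \<in> E then ?X - ?Y else {})"
      by auto
    then show ?thesis by simp
  qed
  also have "\<dots> = emeasure M (if True \<in> E then ?Y else {}) + emeasure M (if False \<in> E then ?X - ?Y else {})"
    by (rule plus_emeasure[symmetric]) (use X Y in auto)
  finally show ?thesis unfolding d by simp
qed

lemma restrict_in_prod_emb_iff:
  assumes "J \<subseteq> A"
  shows "restrict f A \<in> prod_emb A (\<lambda>_. count_space UNIV) J (PiE J E) \<longleftrightarrow> (\<forall>j\<in>J. f j \<in> E j)"
  using assms by (auto simp: prod_emb_def Int_absorb1 Int_absorb2 restrict_PiE_iff)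

lemma emeasure_prod_emb_restrict:
  fixes P :: "'b measure" and g :: "'b \<Rightarrow> 'i \<Rightarrow> bool"
  assumes "\<And>j. j \<in> A \<Longrightarrow> (\<lambda>x. g x j) \<in> measurable P (count_space UNIV)" "J \<subseteq> A" "finite J"
  shows "emeasure (distr P (PiM A (\<lambda>_. count_space UNIV)) (\<lambda>x. restrict (g x) A))
      (prod_emb A (\<lambda>_. count_space UNIV) J (PiE J E)) = emeasure P {x \<in> space P. \<forall>j\<in>J. g x j \<in> E j}"
proof -
  have m: "(\<lambda>x. restrict (g x) A) \<in> measurable P (PiM A (\<lambda>_. count_space UNIV))"
    by (intro measurable_restrict assms)
  show ?thesis
    using assms(2,3) by (subst emeasure_distr[OF m sets_PiM_I])
      (auto simp: restrict_in_prod_emb_iff Int_def conj_commute)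
qed

lemma distr_eqI_finite_cylinders:
  fixes g :: "'b \<Rightarrow> 'i \<Rightarrow> bool" and g' :: "'c \<Rightarrow> 'i \<Rightarrow> bool"
  assumes "prob_space P" "prob_space Q"
    and "\<And>j. j \<in> A \<Longrightarrow> (\<lambda>x. g x j) \<in> measurable P (count_space UNIV)"
    and "\<And>j. j \<in> A \<Longrightarrow> (\<lambda>x. g' x j) \<in> measurable Q (count_space UNIV)"
    and eq: "\<And>J E. finite J \<Longrightarrow> J \<noteq> {} \<Longrightarrow> J \<subseteq> A \<Longrightarrow>
      emeasure P {x \<in> space P. \<forall>j\<in>J. g x j \<in> E j} = emeasure Q {x \<in> space Q. \<forall>j\<in>J. g' x j \<in> E j}"
  shows "distr P (PiM A (\<lambda>_. count_space UNIV)) (\<lambda>x. restrict (g x) A)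
    = distr Q (PiM A (\<lambda>_. count_space UNIV)) (\<lambda>x. restrict (g' x) A)"
proof -
  interpret P: prob_space P by fact
  interpret Q: prob_space Q by fact
  interpret D: prob_space "distr P (PiM A (\<lambda>_. count_space UNIV)) (\<lambda>x. restrict (g x) A)"
    by (intro P.prob_space_distr measurable_restrict assms)
  show ?thesis
  proof (rule measure_eqI_PiM_infinite)
    fix E J assume J: "finite J" "J \<subseteq> A"
    show "emeasure (distr P (PiM A (\<lambda>_. count_space UNIV)) (\<lambda>x. restrict (g x) A)) (prod_emb A (\<lambda>_. count_space UNIV) J (PiE J E))
      = emeasure (distr Q (PiM A (\<lambda>_. count_space UNIV)) (\<lambda>x. restrict (g' x) A)) (prod_emb A (\<lambda>_. count_space UNIV) J (PiE J E))"
      using emeasure_prod_emb_restrict[OF assms(3) J(2,1)] emeasure_prod_emb_restrict[OF assms(4) J(2,1)]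
        eq[OF J(1) _ J(2)] P.emeasure_space_1 Q.emeasure_space_1 by (cases "J = {}") auto
  qed (auto intro: D.finite_measure_axioms simp: )
qed

lemma finite_has_greatest_wo:
  assumes "finite J" "J \<noteq> {}" "J \<subseteq> I" "well_order_on I r"
  shows "\<exists>m\<in>J. \<forall>j\<in>J. (j, m) \<in> r"
  using assms
proof (induction rule: finite_ne_induct)
  case (singleton x)
  then show ?case by (auto simp: order_on_defs refl_on_def)
next
  case (insert x F)
  then obtain m where m: "m \<in> F" "\<forall>j\<in>F. (j, m) \<in> r" by auto
  have "(x, m) \<in> r \<or> (m, x) \<in> r" "(x, x) \<in> r" "trans r"
    using insert.prems m(1) insert.hyps by (auto simp: order_on_defs refl_on_def total_on_def)
  then show ?case
  proof (elim disjE)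
    assume "(x, m) \<in> r"
    then show ?thesis using m by auto
  next
    assume "(m, x) \<in> r"
    then have "\<forall>j\<in>insert x F. (j, x) \<in> r"
      using m \<open>(x, x) \<in> r\<close> \<open>trans r\<close> by (auto dest: transD)
    then show ?thesis by auto
  qed
qed

text \<open>Membership of the random point in \<open>H i\<close> is decided by recursion along a well-order of \<open>I\<close>:
  the \<open>i\<close>-th uniform seed is compared with the conditional probability of \<open>H i\<close> given the
  decisions made so far. This replaces Maharam's theorem.\<close>

lemma unit_cube_represents:
  fixes H :: "'i \<Rightarrow> 'a set"
  assumes M: "prob_space M" and H: "\<And>i. i \<in> I \<Longrightarrow> H i \<in> sets M"
  obtains \<phi> where "\<phi> \<in> measurable (PiM I (\<lambda>_. unit_measure)) (PiM I (\<lambda>_. count_space UNIV))"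
    "distr (PiM I (\<lambda>_. unit_measure)) (PiM I (\<lambda>_. count_space UNIV)) \<phi>
      = distr M (PiM I (\<lambda>_. count_space UNIV)) (\<lambda>x. \<lambda>i\<in>I. x \<in> H i)"
proof -
  let ?U = "\<lambda>A :: 'i set. PiM A (\<lambda>_. unit_measure)"
  let ?B = "\<lambda>A :: 'i set. PiM A (\<lambda>_. count_space (UNIV :: bool set))"
  define h where "h A = (\<lambda>x. restrict (\<lambda>i. x \<in> H i) A)" for A
  interpret M: prob_space M by fact
  have U: "prob_space (?U A)" for A by (intro prob_space_PiM prob_space_unit_measure)
  obtain r where r: "well_order_on I r" using well_order_on by blast
  then have rI: "r \<subseteq> I \<times> I" "trans r" "antisym r" "total_on I r" "refl_on I r" and wf: "wf (r - Id)"
    by (auto simp: order_on_defs)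
  define L where "L i = {j. (j, i) \<in> r - Id}" for i
  have LI: "L i \<subseteq> I" for i using rI(1) by (auto simp: L_def)
  have iL: "i \<notin> L i" for i by (simp add: L_def)
  have L_trans: "L j \<subseteq> L i" if "j \<in> L i" for i j
    using that rI(2,3) by (auto simp: L_def dest: transD antisymD)
  have Hm: "(\<lambda>x. x \<in> H i) \<in> measurable M (count_space UNIV)" if "i \<in> I" for i
  proof -
    have [measurable]: "H i \<in> sets M" by (rule H) fact
    show ?thesis by measurable
  qed
  have hm: "h A \<in> measurable M (?B A)" if "A \<subseteq> I" for A
    unfolding h_def using that by (intro measurable_restrict Hm) auto
  \<comment> \<open>\<open>dens i q\<close> says that \<open>q\<close> is the conditional
    probability of \<open>H i\<close>, given the pattern of membership in the \<open>H j\<close> for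
    all predecessors j of i.\<close>
  define dens where "dens i q \<longleftrightarrow> q \<in> borel_measurable (?B (L i)) \<and> (\<forall>x. q x \<le> (1::ennreal)) \<and>
     (\<forall>A\<in>sets (?B (L i)). (\<integral>\<^sup>+x. q x * indicator A x \<partial>distr M (?B (L i)) (h (L i)))
       = emeasure M (h (L i) -` A \<inter> H i \<inter> space M))" for i q
  have "\<forall>i\<in>I. \<exists>q. dens i q"
  proof
    fix i assume i: "i \<in> I"
    show "\<exists>q. dens i q"
      unfolding dens_def by (rule conditional_probability_density[OF M hm[OF LI] H[OF i]]) blast
  qed
  then obtain q where "\<forall>i\<in>I. dens i (q i)"
    by (rule bchoice[THEN exE])
  then have q: "\<And>i. i \<in> I \<Longrightarrow> q i \<in> borel_measurable (?B (L i))" "\<And>i x. i \<in> I \<Longrightarrow> q i x \<le> 1"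
    "\<And>i A. i \<in> I \<Longrightarrow> A \<in> sets (?B (L i)) \<Longrightarrow> (\<integral>\<^sup>+x. q i x * indicator A x \<partial>distr M (?B (L i)) (h (L i))) = emeasure M (h (L i) -` A \<inter> H i \<inter> space M)"
    by (simp_all add: dens_def)
  define \<phi> where "\<phi> t = wfrec (r - Id) (\<lambda>f i. ennreal (t i) \<le> q i (restrict f (L i)))" for t
  have \<phi>: "\<phi> t i \<longleftrightarrow> ennreal (t i) \<le> q i (restrict (\<phi> t) (L i))" for t i
  proof -
    have "restrict (cut (\<phi> t) (r - Id) i) (L i) = restrict (\<phi> t) (L i)"
      by (auto simp: restrict_def cut_def L_def)
    then show ?thesis unfolding \<phi>_def by (subst wfrec[OF wf]) (simp add: \<phi>_def)
  qed
  \<comment> \<open>Decisions on a downward closed set depend only on the seeds in that set. For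
    this reason seed i is independent of all decisions made before i.\<close>
  have loc: "\<phi> (restrict t A) j = \<phi> t j" if "j \<in> A" "\<And>j. j \<in> A \<Longrightarrow> L j \<subseteq> A" for t A j
    using that(1)
  proof (induction j rule: wf_induct_rule[OF wf])
    case (1 j)
    have "restrict (\<phi> (restrict t A)) (L j) = restrict (\<phi> t) (L j)"
    proof (rule restrict_ext)
      fix k assume k: "k \<in> L j"
      show "\<phi> (restrict t A) k = \<phi> t k"
      proof (rule 1(1))
        show "(k, j) \<in> r - Id" using k by (simp add: L_def)
        show "k \<in> A" using k that(2)[OF 1(2)] by blast
      qed
    qed
    moreover have "restrict t A j = t j" using 1(2) by simp
    ultimately show ?case by (simp only: \<phi>[of _ j])
  qed
  have meas: "(\<lambda>t. \<phi> t j) \<in> measurable (?U A) (count_space UNIV)"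
    if "j \<in> A" "A \<subseteq> I" "\<And>j. j \<in> A \<Longrightarrow> L j \<subseteq> A" for A j
    using that(1)
  proof (induction j rule: wf_induct_rule[OF wf])
    case (1 j)
    have [measurable]: "(\<lambda>t. restrict (\<phi> t) (L j)) \<in> measurable (?U A) (?B (L j))"
    proof (rule measurable_restrict)
      fix k assume k: "k \<in> L j"
      show "(\<lambda>t. \<phi> t k) \<in> measurable (?U A) (count_space UNIV)"
      proof (rule 1(1))
        show "(k, j) \<in> r - Id" using k by (simp add: L_def)
        show "k \<in> A" using k that(3)[OF 1(2)] by blast
      qed
    qed
    have [measurable]: "q j \<in> borel_measurable (?B (L j))" using q(1) 1 that(2) by auto
    have [measurable]: "(\<lambda>t. t j) \<in> borel_measurable (?U A)"
      using measurable_component_singleton[of j A "\<lambda>_. unit_measure"] 1 by simp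
    have "(\<lambda>t. q j (restrict (\<phi> t) (L j))) \<in> borel_measurable (?U A)" "(\<lambda>t. ennreal (t j)) \<in> borel_measurable (?U A)"
      by measurable
    then show ?case unfolding \<phi>[of _ j] unfolding pred_def by (rule borel_measurable_le[rotated])
  qed
  \<comment> \<open>The invariant speaks of finite sets of indices up to i only. Limit stages need
    no extra argument: a finite set has a greatest element m, and \<open>good m\<close> covers
    it.\<close>
  define good where "good i \<longleftrightarrow> (\<forall>J E. finite J \<longrightarrow> J \<subseteq> insert i (L i) \<longrightarrow>
     emeasure (?U I) {t \<in> space (?U I). \<forall>j\<in>J. \<phi> t j \<in> E j} = emeasure M {x \<in> space M. \<forall>j\<in>J. (x \<in> H j) \<in> E j})" for i
  have law: "distr (?U I) (?B A) (\<lambda>t. restrict (\<phi> t) A) = distr M (?B A) (h A)"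
    if A: "A \<subseteq> I" "\<And>j. j \<in> A \<Longrightarrow> good j" for A
    unfolding h_def
  proof (rule distr_eqI_finite_cylinders[OF U M])
    fix J E assume J: "finite J" "J \<noteq> {}" "J \<subseteq> A"
    then obtain m where m: "m \<in> J" "\<forall>j\<in>J. (j, m) \<in> r"
      using finite_has_greatest_wo[OF _ _ _ r, of J] A by auto
    then have "J \<subseteq> insert m (L m)" by (auto simp: L_def)
    then show "emeasure (?U I) {t \<in> space (?U I). \<forall>j\<in>J. \<phi> t j \<in> E j} = emeasure M {x \<in> space M. \<forall>j\<in>J. (x \<in> H j) \<in> E j}"
      using A(2)[of m] m J unfolding good_def by blast
  qed (use A LI in \<open>auto intro!: meas Hm\<close>)
  have good: "good i" if "i \<in> I" for i
    using that
  proof (induction i rule: wf_induct_rule[OF wf])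
    case (1 i)
    note i = \<open>i \<in> I\<close>
    have lawL: "distr (?U I) (?B (L i)) (\<lambda>t. restrict (\<phi> t) (L i)) = distr M (?B (L i)) (h (L i))"
      using 1 LI by (intro law) (auto simp: L_def)
    define \<Phi> where "\<Phi> t = restrict (\<phi> t) (L i)" for t
    have \<Phi>r: "\<Phi> (restrict t (L i)) = \<Phi> t" for t
      unfolding \<Phi>_def using L_trans by (intro restrict_ext loc) auto
    have \<Phi>m: "\<Phi> \<in> measurable (?U A) (?B (L i))" if "A \<subseteq> I" "\<And>j. j \<in> A \<Longrightarrow> L j \<subseteq> A" "L i \<subseteq> A" for A
      unfolding \<Phi>_def using that by (intro measurable_restrict meas) auto
    have \<Phi>I[measurable]: "\<Phi> \<in> measurable (?U I) (?B (L i))" and \<Phi>L[measurable]: "\<Phi> \<in> measurable (?U (L i)) (?B (L i))"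
      using \<Phi>m[of I] \<Phi>m[of "L i"] LI L_trans by auto
    have lawL': "distr (?U (L i)) (?B (L i)) \<Phi> = distr M (?B (L i)) (h (L i))"
    proof -
      have "distr (?U I) (?U (L i)) (\<lambda>t. restrict t (L i)) = ?U (L i)"
        using distr_PiM_reindex[of I "\<lambda>_. unit_measure" "\<lambda>x. x" "L i"] prob_space_unit_measure LI by auto
      then have "distr (?U (L i)) (?B (L i)) \<Phi> = distr (distr (?U I) (?U (L i)) (\<lambda>t. restrict t (L i))) (?B (L i)) \<Phi>"
        by simp
      also have "\<dots> = distr (?U I) (?B (L i)) (\<lambda>t. \<Phi> t)"
        by (subst distr_distr[OF \<Phi>L measurable_restrict_subset[OF LI]]) (simp add: comp_def \<Phi>r)
      finally show ?thesis using lawL by (simp add: \<Phi>_def)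
    qed
    have lawA: "emeasure (?U I) {t \<in> space (?U I). \<Phi> t \<in> A} = emeasure M {x \<in> space M. h (L i) x \<in> A}"
      if A: "A \<in> sets (?B (L i))" for A
    proof -
      have "(\<lambda>t. restrict (\<phi> t) (L i)) = \<Phi>" by (simp add: fun_eq_iff \<Phi>_def)
      then show ?thesis
        using lawL emeasure_distr[OF \<Phi>I A] emeasure_distr[OF hm[OF LI] A]
        by (simp add: vimage_def Int_def conj_commute)
    qed
    \<comment> \<open>By the threshold lemma the left side is the integral of \<open>q i\<close>
      over \<open>A\<close> with respect to the law of the earlier decisions. This law is the true
      one by induction, and the choice of \<open>q i\<close> evaluates the integral.\<close>
    have lawAi: "emeasure (?U I) {t \<in> space (?U I). \<Phi> t \<in> A \<and> \<phi> t i} = emeasure M {x \<in> space M. h (L i) x \<in> A \<and> x \<in> H i}"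
      if A: "A \<in> sets (?B (L i))" for A
      using emeasure_threshold[OF iL _ \<Phi>L q(1)[OF i] q(2)[OF i] A, of I] q(3)[OF i A] LI i
      unfolding lawL' \<Phi>r by (simp add: \<phi>[of _ i] \<Phi>_def vimage_def Int_def conj_ac)
    show "good i"
      unfolding good_def
    proof (intro allI impI)
      fix J and E :: "'i \<Rightarrow> bool set" assume J: "finite J" "J \<subseteq> insert i (L i)"
      define A where "A = prod_emb (L i) (\<lambda>_. count_space UNIV) (J - {i}) (PiE (J - {i}) E)"
      have A[measurable]: "A \<in> sets (?B (L i))"
        unfolding A_def using J by (intro sets_PiM_I) auto
      have AJ: "restrict f (L i) \<in> A \<longleftrightarrow> (\<forall>j\<in>J - {i}. f j \<in> E j)" for f
        using J unfolding A_def by (intro restrict_in_prod_emb_iff) auto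
      \<comment> \<open>If i does not occur in \<open>J\<close>, it is put under the void condition,
        which allows one treatment of both cases.\<close>
      define E' where "E' = (if i \<in> J then E i else UNIV)"
      have e1: "(\<forall>j\<in>J. f j \<in> E j) \<longleftrightarrow> restrict f (L i) \<in> A \<and> f i \<in> E'" for f
        unfolding AJ E'_def by auto
      interpret UI: prob_space "?U I" by (rule U)
      have [measurable]: "(\<lambda>t. \<phi> t i) \<in> measurable (?U I) (count_space UNIV)" using i LI by (intro meas) auto
      have [measurable]: "h (L i) \<in> measurable M (?B (L i))" "H i \<in> sets M" using hm[OF LI] H[OF i] by auto
      have "emeasure (?U I) {t \<in> space (?U I). \<Phi> t \<in> A \<and> \<phi> t i \<in> E'} = emeasure M {x \<in> space M. h (L i) x \<in> A \<and> (x \<in> H i) \<in> E'}"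
        by (subst UI.emeasure_bool_split, measurable, subst M.emeasure_bool_split, measurable) (simp add: lawA[OF A] lawAi[OF A])
      then show "emeasure (?U I) {t \<in> space (?U I). \<forall>j\<in>J. \<phi> t j \<in> E j} = emeasure M {x \<in> space M. \<forall>j\<in>J. (x \<in> H j) \<in> E j}"
        unfolding e1 h_def \<Phi>_def .
    qed
  qed
  show ?thesis
  proof
    show "(\<lambda>t. restrict (\<phi> t) I) \<in> measurable (?U I) (?B I)"
      using LI by (intro measurable_restrict meas) auto
    show "distr (?U I) (?B I) (\<lambda>t. restrict (\<phi> t) I) = distr M (?B I) (\<lambda>x. \<lambda>i\<in>I. x \<in> H i)"
      using law[of I] good by (auto simp: h_def)
  qed
qed

section \<open>Random sequences that avoid few null sets\<close>

text \<open>N independent trials all miss \<open>B\<close> with probability \<open>c ^ N\<close>,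
  where c is the probability of a single miss and is less than 1.\<close>

lemma null_sets_PiM_never_in:
  assumes \<nu>: "prob_space \<nu>" and B: "B \<in> sets \<nu>" "emeasure \<nu> B > 0"
  shows "{w \<in> space (PiM (UNIV :: nat set) (\<lambda>_. \<nu>)). \<forall>n. w n \<notin> B} \<in> null_sets (PiM UNIV (\<lambda>_. \<nu>))"
proof -
  interpret \<nu>: prob_space \<nu> by fact
  interpret P: prob_space "PiM (UNIV :: nat set) (\<lambda>_. \<nu>)" by (intro prob_space_PiM \<nu>)
  let ?P = "PiM (UNIV :: nat set) (\<lambda>_. \<nu>)"
  let ?W = "{w \<in> space ?P. \<forall>n. w n \<notin> B}"
  have [measurable]: "B \<in> sets \<nu>" by fact
  have W[measurable]: "?W \<in> sets ?P" by measurable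
  define c where "c = measure \<nu> (space \<nu> - B)"
  have c: "c < 1" "0 \<le> c"
    using B \<nu>.prob_compl[of B] by (auto simp: c_def \<nu>.emeasure_eq_measure)
  have le: "measure ?P ?W \<le> c ^ N" for N
  proof -
    have "emeasure ?P ?W \<le> emeasure ?P (prod_emb UNIV (\<lambda>_. \<nu>) {..<N} (PiE {..<N} (\<lambda>_. space \<nu> - B)))"
      by (rule emeasure_mono) (auto simp: prod_emb_def space_PiM PiE_def Pi_def intro!: sets_PiM_I)
    also have "\<dots> = (\<Prod>i\<in>{..<N}. emeasure \<nu> (space \<nu> - B))"
      by (rule emeasure_PiM_emb) (use \<nu> in auto)
    also have "\<dots> = ennreal (c ^ N)"
      by (simp add: c_def \<nu>.emeasure_eq_measure ennreal_power)
    finally show ?thesis using c by (simp add: P.emeasure_eq_measure)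
  qed
  have "(\<lambda>N. c ^ N) \<longlonglongrightarrow> 0" using c by (intro LIMSEQ_power_zero) auto
  then have "measure ?P ?W \<le> 0" by (rule LIMSEQ_le_const) (use le in auto)
  then show ?thesis using W by (simp add: null_sets_def P.emeasure_eq_measure measure_le_0_iff)
qed

text \<open>Row i of the coins, read as a binary expansion, is the uniform seed for index i.
  Replacing seeds by coins costs a factor \<open>nat\<close> in the index set, which is harmless for
  infinite cardinals.\<close>

lemma coins_represent:
  fixes H :: "'i \<Rightarrow> 'a set"
  assumes M: "prob_space M" and H: "\<And>i. i \<in> I \<Longrightarrow> H i \<in> sets M" and I: "I \<noteq> {}"
  obtains X where "X \<in> measurable (coins (I \<times> (UNIV :: nat set))) (PiM I (\<lambda>_. count_space UNIV))"
    "distr (coins (I \<times> (UNIV :: nat set))) (PiM I (\<lambda>_. count_space UNIV)) X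
      = distr M (PiM I (\<lambda>_. count_space UNIV)) (\<lambda>x. \<lambda>i\<in>I. x \<in> H i)"
proof -
  let ?U = "PiM I (\<lambda>_. unit_measure)" and ?C = "coins (I \<times> (UNIV :: nat set))"
  obtain \<phi> where \<phi>: "\<phi> \<in> measurable ?U (PiM I (\<lambda>_. count_space UNIV))"
    "distr ?U (PiM I (\<lambda>_. count_space UNIV)) \<phi> = distr M (PiM I (\<lambda>_. count_space UNIV)) (\<lambda>x. \<lambda>i\<in>I. x \<in> H i)"
    by (rule unit_cube_represents[of M I H, OF M H])
  define Y where "Y b = (\<lambda>l\<in>I. binary_value (\<lambda>s\<in>UNIV. b (id (l, s))))" for b :: "'i \<times> nat \<Rightarrow> bool"
  have bm: "binary_value \<in> measurable (coins UNIV) unit_measure"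
    using measurable_binary_value by (simp cong: measurable_cong_sets)
  have bd: "distr (coins UNIV) unit_measure binary_value = unit_measure"
    unfolding distr_binary_value[symmetric] by (rule distr_cong) auto
  have "distr ?C ?U Y = PiM I (\<lambda>_. distr (coins UNIV) unit_measure binary_value)"
    unfolding Y_def[abs_def] by (rule distr_PiM_blocks[OF prob_space_coin]) (use I bm in auto)
  then have Y: "distr ?C ?U Y = ?U" by (simp only: bd)
  have YU: "Y \<in> measurable ?C ?U"
    unfolding Y_def[abs_def]
    by (intro measurable_restrict measurable_compose[OF _ bm] measurable_component_singleton) auto
  have "distr ?C (PiM I (\<lambda>_. count_space UNIV)) (\<phi> \<circ> Y) = distr (distr ?C ?U Y) (PiM I (\<lambda>_. count_space UNIV)) \<phi>"
    by (rule distr_distr[OF \<phi>(1) YU, symmetric])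
  also have "\<dots> = distr ?U (PiM I (\<lambda>_. count_space UNIV)) \<phi>" by (simp only: Y)
  also note \<phi>(2)
  finally have "distr ?C (PiM I (\<lambda>_. count_space UNIV)) (\<phi> \<circ> Y) = distr M (PiM I (\<lambda>_. count_space UNIV)) (\<lambda>x. \<lambda>i\<in>I. x \<in> H i)" .
  moreover have "\<phi> \<circ> Y \<in> measurable ?C (PiM I (\<lambda>_. count_space UNIV))"
    using YU \<phi>(1) by (rule measurable_comp)
  ultimately show ?thesis using that by blast
qed

lemma card_of_finite_subsets_ordLeq:
  assumes \<kappa>: "Card_order \<kappa>" "infinite (Field \<kappa>)" and I: "|I| \<le>o \<kappa>"
  shows "|{F. finite F \<and> F \<subseteq> I}| \<le>o \<kappa>"
proof -
  have nat\<kappa>: "|UNIV :: nat set| \<le>o \<kappa>"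
    using \<kappa> by (meson card_of_Field_ordIso infinite_iff_card_of_nat ordLeq_ordIso_trans)
  have "|{F. finite F \<and> F \<subseteq> I \<and> card F = n}| \<le>o \<kappa>" for n
  proof (induction n)
    case 0
    have "{F. finite F \<and> F \<subseteq> I \<and> card F = 0} \<subseteq> (\<lambda>_ :: nat. {}) ` UNIV" by auto
    then have "|{F. finite F \<and> F \<subseteq> I \<and> card F = 0}| \<le>o |UNIV :: nat set|"
      by (rule surj_imp_ordLeq)
    then show ?case using nat\<kappa> by (rule ordLeq_transitive)
  next
    case (Suc n)
    have "{F. finite F \<and> F \<subseteq> I \<and> card F = Suc n} \<subseteq> (\<lambda>(i, F). insert i F) ` (I \<times> {F. finite F \<and> F \<subseteq> I \<and> card F = n})"
      by (force simp: card_Suc_eq)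
    then have "|{F. finite F \<and> F \<subseteq> I \<and> card F = Suc n}| \<le>o |I \<times> {F. finite F \<and> F \<subseteq> I \<and> card F = n}|"
      by (rule surj_imp_ordLeq)
    also have "|I \<times> {F. finite F \<and> F \<subseteq> I \<and> card F = n}| \<le>o \<kappa>"
      by (rule card_of_Times_ordLeq_infinite_Field) (use \<kappa> I Suc in auto)
    finally show ?case .
  qed
  then have "|\<Union>n. {F. finite F \<and> F \<subseteq> I \<and> card F = n}| \<le>o \<kappa>"
    by (intro card_of_UNION_ordLeq_infinite_Field) (use \<kappa> nat\<kappa> in auto)
  moreover have "(\<Union>n. {F. finite F \<and> F \<subseteq> I \<and> card F = n}) = {F. finite F \<and> F \<subseteq> I}" by auto
  ultimately show ?thesis by simp
qed

text \<open>A sequence of independent samples of the joint law of the \<open>H i\<close>, taken outside at most \<open>\<kappa>\<close>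
  null sets, meets every \<open>H i\<close> and only meets finite intersections of positive measure.\<close>

lemma countable_centered_cover:
  fixes H :: "'i \<Rightarrow> 'a set" and J :: "'j set"
  assumes M: "prob_space M" and H: "\<And>i. i \<in> I \<Longrightarrow> H i \<in> sets M" "\<And>i. i \<in> I \<Longrightarrow> emeasure M (H i) > 0"
    and \<kappa>: "Card_order \<kappa>" "infinite (Field \<kappa>)" "|I| \<le>o \<kappa>" "\<kappa> \<le>o |J|"
    and cov: "\<And>\<N>. \<N> \<subseteq> null_sets (coins J) \<Longrightarrow> |\<N>| \<le>o \<kappa> \<Longrightarrow> \<exists>b\<in>space (coins J). b \<notin> \<Union>\<N>"
  obtains A :: "nat \<Rightarrow> 'i set" where "I \<subseteq> (\<Union>n. A n)"
    "\<And>n F. finite F \<Longrightarrow> F \<subseteq> A n \<inter> I \<Longrightarrow> emeasure M {x \<in> space M. \<forall>i\<in>F. x \<in> H i} > 0"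
proof (cases "I = {}")
  case True
  interpret prob_space M by fact
  show ?thesis
    by (rule that[of "\<lambda>_. {}"]) (use True emeasure_space_1 in auto)
next
  case False
  let ?S = "I \<times> (UNIV :: nat set)"
  let ?B = "PiM I (\<lambda>_. count_space (UNIV :: bool set))"
  obtain X where X: "X \<in> measurable (coins ?S) ?B"
    "distr (coins ?S) ?B X = distr M ?B (\<lambda>x. \<lambda>i\<in>I. x \<in> H i)"
    by (rule coins_represent[of M I H, OF M H(1) False])
  have nat\<kappa>: "|UNIV :: nat set| \<le>o \<kappa>"
    using \<kappa>(1,2) by (meson card_of_Field_ordIso infinite_iff_card_of_nat ordLeq_ordIso_trans)
  have times: "|Y \<times> Z| \<le>o \<kappa>" if "|Y| \<le>o \<kappa>" "|Z| \<le>o \<kappa>" for Y :: "'p set" and Z :: "'q set"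
    by (rule card_of_Times_ordLeq_infinite_Field) (use that \<kappa> in auto)
  have S\<kappa>: "|?S| \<le>o \<kappa>" by (intro times nat\<kappa> \<kappa>)
  have "|(UNIV :: nat set) \<times> ?S| \<le>o \<kappa>"
    by (rule card_of_Times_ordLeq_infinite_Field) (use nat\<kappa> S\<kappa> \<kappa> in auto)
  then have "|(UNIV :: nat set) \<times> ?S| \<le>o |J|" using \<kappa>(4) by (rule ordLeq_transitive)
  \<comment> \<open>Sample n reads the coins at the positions \<open>e (n, s)\<close>. Different
    samples use disjoint sets of coins and are therefore independent.\<close>
  then obtain e where e: "inj_on e ((UNIV :: nat set) \<times> ?S)" "e ` ((UNIV :: nat set) \<times> ?S) \<subseteq> J"
    by (auto simp: card_of_ordLeq[symmetric])
  define \<Psi> where "\<Psi> b = (\<lambda>n\<in>(UNIV :: nat set). X (\<lambda>s\<in>?S. b (e (n, s))))" for b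
  let ?\<nu> = "distr M ?B (\<lambda>x. \<lambda>i\<in>I. x \<in> H i)"
  have \<Psi>: "distr (coins J) (PiM UNIV (\<lambda>_. ?B)) \<Psi> = PiM UNIV (\<lambda>_. ?\<nu>)"
    unfolding \<Psi>_def[abs_def] X(2)[symmetric]
    using False by (intro distr_PiM_blocks[OF prob_space_coin e _ _ X(1)]) auto
  have eJ: "e (n, s) \<in> J" if "s \<in> ?S" for n s using e(2) that by blast
  have \<Psi>m: "\<Psi> \<in> measurable (coins J) (PiM UNIV (\<lambda>_. ?B))"
    unfolding \<Psi>_def[abs_def]
    by (intro measurable_restrict measurable_compose[OF _ X(1)] measurable_component_singleton eJ)
  have Hm: "(\<lambda>x. \<lambda>i\<in>I. x \<in> H i) \<in> measurable M ?B"
  proof (rule measurable_restrict)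
    fix i assume "i \<in> I"
    then have [measurable]: "H i \<in> sets M" by (rule H)
    show "(\<lambda>x. x \<in> H i) \<in> measurable M (count_space UNIV)" by measurable
  qed
  have \<nu>: "prob_space ?\<nu>" by (rule prob_space.prob_space_distr[OF M Hm])
  interpret P\<nu>: product_prob_space "\<lambda>_. ?\<nu>" "UNIV :: nat set"
    by (intro product_prob_spaceI \<nu>)
  have null_pull: "\<Psi> -` W \<inter> space (coins J) \<in> null_sets (coins J)" if "W \<in> null_sets (PiM UNIV (\<lambda>_. ?\<nu>))" for W
    using that null_sets_distr_iff[OF \<Psi>m, of W] unfolding \<Psi> by simp
  define C where "C F = {f \<in> space ?B. \<forall>i\<in>F. f i}" for F
  have C: "C F \<in> sets ?B" if "finite F" "F \<subseteq> I" for F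
  proof -
    have "C F = space ?B \<inter> (\<Inter>i\<in>F. (\<lambda>f. f i) -` {True} \<inter> space ?B)" by (auto simp: C_def)
    moreover have "(\<lambda>f. f i) -` {True} \<inter> space ?B \<in> sets ?B" if "i \<in> I" for i
      by (rule measurable_sets[OF measurable_component_singleton[OF that]]) auto
    ultimately show ?thesis using that
      by (metis (no_types, lifting) sets.Int_space_eq1 sets.finite_INT sets.top subsetD INT_empty Int_UNIV_right)
  qed
  have \<nu>C: "emeasure ?\<nu> (C F) = emeasure M {x \<in> space M. \<forall>i\<in>F. x \<in> H i}" if "finite F" "F \<subseteq> I" for F
    using that by (subst emeasure_distr[OF Hm C[OF that]])
      (auto simp: C_def space_PiM intro!: arg_cong[where f="emeasure M"])
  \<comment> \<open>\<open>N1 i\<close> is the event that no sample satisfies \<open>H i\<close>.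
    \<open>N2 (n, F)\<close> is the event that sample n satisfies all \<open>H i\<close> for i in
    \<open>F\<close>; it is used only when these sets have a null intersection. Both kinds are null,
    and there are at most \<kappa> of them, since \<kappa> bounds the number of finite subsets of
    \<open>I\<close>.\<close>
  define N1 where "N1 i = \<Psi> -` {w \<in> space (PiM UNIV (\<lambda>_. ?\<nu>)). \<forall>n. w n \<notin> C {i}} \<inter> space (coins J)" for i
  define N2 where "N2 = (\<lambda>(n :: nat, F). \<Psi> -` ((\<lambda>w. w n) -` C F \<inter> space (PiM UNIV (\<lambda>_. ?\<nu>))) \<inter> space (coins J))"
  define \<F> where "\<F> = {F \<in> Fpow I. emeasure M {x \<in> space M. \<forall>i\<in>F. x \<in> H i} = 0}"
  define \<N> where "\<N> = N1 ` I \<union> N2 ` (UNIV \<times> \<F>)"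
  have "\<N> \<subseteq> null_sets (coins J)"
  proof -
    have "N1 i \<in> null_sets (coins J)" if "i \<in> I" for i
      unfolding N1_def
    proof (intro null_pull null_sets_PiM_never_in \<nu>)
      show "C {i} \<in> sets ?\<nu>" using C[of "{i}"] that by simp
      have "{x \<in> space M. x \<in> H i} = H i" using sets.sets_into_space[OF H(1)[OF that]] by auto
      then show "emeasure ?\<nu> (C {i}) > 0" using \<nu>C[of "{i}"] H(2)[OF that] that by simp
    qed
    moreover have "N2 (n, F) \<in> null_sets (coins J)" if "F \<in> \<F>" for n F
    proof -
      have F: "finite F" "F \<subseteq> I" using that by (auto simp: \<F>_def Fpow_def)
      have "C F \<in> null_sets ?\<nu>" using F that C[OF F] \<nu>C[OF F] by (auto simp: null_sets_def \<F>_def)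
      then have "(\<lambda>w. w n) -` C F \<inter> space (PiM UNIV (\<lambda>_. ?\<nu>)) \<in> null_sets (PiM UNIV (\<lambda>_. ?\<nu>))"
        using null_sets_distr_iff[of "\<lambda>w. w n" "PiM UNIV (\<lambda>_. ?\<nu>)" ?\<nu> "C F"] P\<nu>.PiM_component[of n] by simp
      then show ?thesis unfolding N2_def prod.case by (rule null_pull)
    qed
    ultimately show ?thesis unfolding \<N>_def by auto
  qed
  moreover have "|\<N>| \<le>o \<kappa>"
  proof -
    have "|\<F>| \<le>o |{F. finite F \<and> F \<subseteq> I}|"
      by (rule card_of_mono1) (auto simp: \<F>_def Fpow_def)
    then have "|\<F>| \<le>o \<kappa>"
      using card_of_finite_subsets_ordLeq[OF \<kappa>(1,2,3)] by (rule ordLeq_transitive)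
    then have "|(UNIV :: nat set) \<times> \<F>| \<le>o \<kappa>"
      by (intro card_of_Times_ordLeq_infinite_Field) (use nat\<kappa> \<kappa> in auto)
    then have "|N2 ` (UNIV \<times> \<F>)| \<le>o \<kappa>" using card_of_image ordLeq_transitive by blast
    moreover have "|N1 ` I| \<le>o \<kappa>" using \<kappa>(3) card_of_image ordLeq_transitive by blast
    ultimately show ?thesis unfolding \<N>_def
      by (intro card_of_Un_ordLeq_infinite_Field) (use \<kappa> in auto)
  qed
  ultimately obtain b where b: "b \<in> space (coins J)" "b \<notin> \<Union>\<N>" using cov by blast
  have \<Psi>b: "\<Psi> b \<in> space (PiM UNIV (\<lambda>_. ?\<nu>))"
    using measurable_space[OF \<Psi>m b(1)] by (simp add: space_PiM)
  show ?thesis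
  proof (rule that[of "\<lambda>n. {i \<in> I. \<Psi> b n \<in> C {i}}"])
    show "I \<subseteq> (\<Union>n. {i \<in> I. \<Psi> b n \<in> C {i}})"
      using b \<Psi>b by (auto simp: \<N>_def N1_def)
    fix n F assume F: "finite F" "F \<subseteq> {i \<in> I. \<Psi> b n \<in> C {i}} \<inter> I"
    show "emeasure M {x \<in> space M. \<forall>i\<in>F. x \<in> H i} > 0"
    proof (rule ccontr)
      assume "\<not> ?thesis"
      then have "F \<in> \<F>" using F by (auto simp: \<F>_def Fpow_def)
      then have "b \<notin> N2 (n, F)" using b by (auto simp: \<N>_def)
      moreover have "\<Psi> b n \<in> C F" using F \<Psi>b by (auto simp: C_def space_PiM)
      ultimately show False using b \<Psi>b by (auto simp: N2_def)
    qed
  qed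
qed

subsection \<open>Compact spaces with a strictly positive measure\<close>

lemma radon_measure_onD:
  assumes "radon_measure_on K \<mu>"
  shows "space \<mu> = topspace K" "finite_measure \<mu>"
    "openin K U \<Longrightarrow> U \<in> sets \<mu>" "closedin K C \<Longrightarrow> C \<in> sets \<mu>"
proof -
  show sp: "space \<mu> = topspace K" and "finite_measure \<mu>"
    and op: "openin K U \<Longrightarrow> U \<in> sets \<mu>" for U
    using assms by (auto simp: radon_measure_on_def)
  show "C \<in> sets \<mu>" if C: "closedin K C"
  proof -
    have "space \<mu> - (topspace K - C) \<in> sets \<mu>"
      by (intro sets.compl_sets op) (use C in \<open>simp add: closedin_def\<close>)
    then show ?thesis using closedin_subset[OF C] by (simp add: sp double_diff)
  qed
qed

lemma positive_closed_subset:
  assumes K: "Hausdorff_space K" and \<mu>: "radon_measure_on K \<mu>"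
    and pos: "\<And>U. openin K U \<Longrightarrow> U \<noteq> {} \<Longrightarrow> emeasure \<mu> U > 0" and U: "openin K U" "U \<noteq> {}"
  shows "\<exists>C. closedin K C \<and> C \<subseteq> U \<and> emeasure \<mu> C > 0"
proof -
  have "0 < (SUP C\<in>{C. compactin K C \<and> C \<subseteq> U}. emeasure \<mu> C)"
    using pos[OF U] \<mu> radon_measure_onD(3)[OF \<mu> U(1)] by (simp add: radon_measure_on_def)
  then show ?thesis using compactin_imp_closedin[OF K] by (auto simp: less_SUP_iff)
qed

lemma emeasure_uniform_space_pos_iff:
  assumes "finite_measure \<mu>" "A \<in> sets \<mu>"
  shows "emeasure (uniform_measure \<mu> (space \<mu>)) A > 0 \<longleftrightarrow> emeasure \<mu> A > 0"
proof -
  interpret finite_measure \<mu> by fact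
  have "space \<mu> \<inter> A = A" using sets.sets_into_space[OF assms(2)] by auto
  then show ?thesis
    using assms by (simp add: ennreal_zero_less_divide less_top[symmetric])
qed

lemma compact_space_common_point:
  assumes K: "compact_space K" "topspace K \<noteq> {}" and C: "\<And>i. i \<in> A \<Longrightarrow> closedin K (C i)"
    and fip: "\<And>F. finite F \<Longrightarrow> F \<subseteq> A \<Longrightarrow> \<exists>x\<in>topspace K. \<forall>i\<in>F. x \<in> C i"
  shows "\<exists>x\<in>topspace K. \<forall>i\<in>A. x \<in> C i"
proof -
  have "\<Inter>(insert (topspace K) (C ` A)) \<noteq> {}"
  proof (rule K(1)[unfolded compact_space_fip, rule_format], intro conjI allI impI ballI)
    fix \<F> assume F: "finite \<F> \<and> \<F> \<subseteq> insert (topspace K) (C ` A)"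
    then have "finite (\<F> - {topspace K})" "\<F> - {topspace K} \<subseteq> C ` A" by auto
    then obtain G where G: "finite G" "G \<subseteq> A" "\<F> - {topspace K} = C ` G"
      by (meson finite_subset_image)
    obtain x where "x \<in> topspace K" "\<forall>i\<in>G. x \<in> C i" using fip[OF G(1,2)] by auto
    then have "x \<in> \<Inter>\<F>" using G(3) by blast
    then show "\<Inter>\<F> \<noteq> {}" by blast
  qed (use C in auto)
  then show ?thesis by auto
qed

text \<open>Each U is shrunk to a closed set \<open>C U\<close> of positive measure. The sets
  assigned to one sample have the finite intersection property, so compactness gives them a common
  point, and that point lies in every U of its class. One point per sample suffices.\<close>

lemma open_sets_hit_by_countable:
  fixes K :: "'a topology" and J :: "'j set"
  assumes K: "compact_space K" "Hausdorff_space K" and \<mu>: "radon_measure_on K \<mu>"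
    and pos: "\<And>U. openin K U \<Longrightarrow> U \<noteq> {} \<Longrightarrow> emeasure \<mu> U > 0"
    and \<U>: "\<And>U. U \<in> \<U> \<Longrightarrow> openin K U" "\<And>U. U \<in> \<U> \<Longrightarrow> U \<noteq> {}"
    and \<kappa>: "Card_order \<kappa>" "infinite (Field \<kappa>)" "|\<U>| \<le>o \<kappa>" "\<kappa> \<le>o |J|"
    and cov: "\<And>\<N>. \<N> \<subseteq> null_sets (coins J) \<Longrightarrow> |\<N>| \<le>o \<kappa> \<Longrightarrow> \<exists>b\<in>space (coins J). b \<notin> \<Union>\<N>"
  obtains Q where "countable Q" "Q \<subseteq> topspace K" "\<And>U. U \<in> \<U> \<Longrightarrow> U \<inter> Q \<noteq> {}"
proof (cases "topspace K = {}")
  case True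
  then have "\<U> = {}" using \<U> openin_subset by fastforce
  then show ?thesis using that[of "{}"] by auto
next
  case False
  note \<mu>D = radon_measure_onD[OF \<mu>]
  have sp: "emeasure \<mu> (space \<mu>) > 0" using pos[of "topspace K"] False by (simp add: \<mu>D)
  define M where "M = uniform_measure \<mu> (space \<mu>)"
  interpret \<mu>: finite_measure \<mu> by (rule \<mu>D)
  have M: "prob_space M"
    unfolding M_def using sp by (intro prob_space_uniform_measure) (auto simp: \<mu>.emeasure_eq_measure)
  have spM: "space M = topspace K" "sets M = sets \<mu>" by (simp_all add: M_def \<mu>D)
  have "\<forall>U\<in>\<U>. \<exists>C. closedin K C \<and> C \<subseteq> U \<and> emeasure \<mu> C > 0"
    using positive_closed_subset[OF K(2) \<mu> pos] \<U> by blast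
  then obtain C where C: "\<And>U. U \<in> \<U> \<Longrightarrow> closedin K (C U)" "\<And>U. U \<in> \<U> \<Longrightarrow> C U \<subseteq> U" "\<And>U. U \<in> \<U> \<Longrightarrow> emeasure \<mu> (C U) > 0"
    by metis
  have Cpos: "C U \<in> sets M" "emeasure M (C U) > 0" if "U \<in> \<U>" for U
  proof -
    have m: "C U \<in> sets \<mu>" using C(1)[OF that] by (rule \<mu>D)
    then show "C U \<in> sets M" by (simp add: spM)
    show "emeasure M (C U) > 0"
      unfolding M_def emeasure_uniform_space_pos_iff[OF \<mu>D(2) m] by (rule C(3)[OF that])
  qed
  obtain A :: "nat \<Rightarrow> 'a set set" where A: "\<U> \<subseteq> (\<Union>n. A n)"
    "\<And>n F. finite F \<Longrightarrow> F \<subseteq> A n \<inter> \<U> \<Longrightarrow> emeasure M {x \<in> space M. \<forall>U\<in>F. x \<in> C U} > 0"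
    using countable_centered_cover[where M=M and I=\<U> and H=C and \<kappa>=\<kappa> and J=J, OF M Cpos \<kappa> cov] by blast
  have "\<exists>x\<in>topspace K. \<forall>U\<in>A n \<inter> \<U>. x \<in> C U" for n
  proof (rule compact_space_common_point[OF K(1) False])
    fix F assume "finite F" "F \<subseteq> A n \<inter> \<U>"
    from A(2)[OF this] have "{x \<in> space M. \<forall>U\<in>F. x \<in> C U} \<noteq> {}" by (metis emeasure_empty less_irrefl)
    then show "\<exists>x\<in>topspace K. \<forall>U\<in>F. x \<in> C U" by (auto simp: spM)
  qed (use C in auto)
  then obtain x where x: "\<And>n. x n \<in> topspace K" "\<And>n U. U \<in> A n \<inter> \<U> \<Longrightarrow> x n \<in> C U" by metis
  show ?thesis
  proof (rule that[of "range x"])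
    show "U \<inter> range x \<noteq> {}" if "U \<in> \<U>" for U
      using A(1) x(2) C(2)[OF that] that by blast
  qed (use x in auto)
qed

text \<open>Density at most \<open>\<cc>\<close>: the points named by well-founded countably branching trees form a set
  closed under picking, for a countable union of members of the chosen pi-bases that is not dense,
  a point outside its closure.\<close>

datatype op_tree = Leaf | Node "nat \<Rightarrow> op_tree" "nat \<Rightarrow> nat set"

text \<open>A tree becomes the set of its labelled paths. A pair with \<open>None\<close> records
  that a node sits at the end of the path; it separates \<open>Leaf\<close> from a node with empty
  labels and leaves below. The pair with \<open>Some (n, k)\<close> records that k belongs to the
  n-th label. Such sets live over a countable type, so there are at most continuum many
  trees.\<close>

primrec op_code :: "op_tree \<Rightarrow> (nat list \<times> (nat \<times> nat) option) set" where
  "op_code Leaf = {}"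
| "op_code (Node f g) = insert ([], None)
    ({([], Some (n, k)) | n k. k \<in> g n} \<union> {(n # l, v) | n l v. (l, v) \<in> op_code (f n)})"

lemma inj_op_code: "inj op_code"
proof (rule injI)
  fix s t show "op_code s = op_code t \<Longrightarrow> s = t"
  proof (induction s arbitrary: t)
    case Leaf
    then show ?case by (cases t) auto
  next
    case (Node f g)
    then obtain f' g' where t: "t = Node f' g'" by (cases t) auto
    have mem: "([], Some (n, k)) \<in> op_code (Node f g) \<longleftrightarrow> k \<in> g n" "(n # l, v) \<in> op_code (Node f g) \<longleftrightarrow> (l, v) \<in> op_code (f n)"
      for f g n k l v by auto
    have "g = g'"
      using Node.prems mem(1)[of _ _ f g] mem(1)[of _ _ f' g'] unfolding t by (intro ext set_eqI) simp
    moreover have "f = f'"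
    proof
      fix n
      have "op_code (f n) = op_code (f' n)"
        using Node.prems mem(2)[of n _ _ f g] mem(2)[of n _ _ f' g'] unfolding t by (auto simp del: op_code.simps)
      then show "f n = f' n" by (rule Node.IH[OF rangeI])
    qed
    ultimately show ?case by (simp add: t)
  qed
qed

lemma card_op_tree: "|UNIV :: op_tree set| \<le>o |UNIV :: (nat \<Rightarrow> bool) set|"
proof -
  have "inj (\<lambda>t. \<lambda>n. n \<in> to_nat ` op_code t)"
  proof (rule injI)
    fix s t assume "(\<lambda>n. n \<in> to_nat ` op_code s) = (\<lambda>n. n \<in> to_nat ` op_code t)"
    then have "to_nat ` op_code s = to_nat ` op_code t" by (auto simp: fun_eq_iff)
    then have "op_code s = op_code t" by (simp add: inj_image_eq_iff)
    then show "s = t" by (rule injD[OF inj_op_code])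
  qed
  then show ?thesis using card_of_ordLeq by blast
qed

text \<open>Here \<open>p x\<close> is meant to enumerate a pi-base at x by subsets of
  \<open>nat\<close>: there are enough of them for a pi-base of size
  \<open>\<omega>\<^sub>1\<close>, and countably many such labels still fit into a tree of the kind
  above. The value at \<open>Leaf\<close> is arbitrary and starts the closing-off.\<close>

primrec op_point :: "'a topology \<Rightarrow> ('a \<Rightarrow> nat set \<Rightarrow> 'a set) \<Rightarrow> op_tree \<Rightarrow> 'a" where
  "op_point K p Leaf = (SOME x. x \<in> topspace K)"
| "op_point K p (Node f g) = (SOME x. x \<in> topspace K \<and>
    (K closure_of (\<Union>n. p (op_point K p (f n)) (g n)) \<noteq> topspace K \<longrightarrow>
      x \<notin> K closure_of (\<Union>n. p (op_point K p (f n)) (g n))))"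

lemma op_point_Node:
  fixes K p f g defines "V \<equiv> \<Union>n. p (op_point K p (f n)) (g n)"
  assumes "topspace K \<noteq> {}"
  shows "op_point K p (Node f g) \<in> topspace K \<and>
    (K closure_of V \<noteq> topspace K \<longrightarrow> op_point K p (Node f g) \<notin> K closure_of V)"
proof -
  have "\<exists>x. x \<in> topspace K \<and> (K closure_of V \<noteq> topspace K \<longrightarrow> x \<notin> K closure_of V)"
    using assms(2) closure_of_subset_topspace[of K V] by blast
  from someI_ex[OF this] show ?thesis unfolding V_def by simp
qed

lemma op_point_in: "topspace K \<noteq> {} \<Longrightarrow> op_point K p t \<in> topspace K"
  using op_point_Node[of K p] by (cases t) (auto simp: some_in_eq)

text \<open>Exhaustion by measure. If the named points miss a neighbourhood of x, regularity puts
  them into an open V whose closure omits x. Among the countable unions of members of their pi-bases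
  inside V, one has the largest measure. It is not dense, so a tree names a point outside its
  closure, and a pi-base member at that point, inside V and disjoint from the union, enlarges the
  measure.\<close>

lemma dense_range_op_point:
  assumes K: "compact_space K" "Hausdorff_space K" "topspace K \<noteq> {}" and \<mu>: "radon_measure_on K \<mu>"
    and pos: "\<And>U. openin K U \<Longrightarrow> U \<noteq> {} \<Longrightarrow> emeasure \<mu> U > 0"
    and p: "\<And>x. x \<in> topspace K \<Longrightarrow> pi_base_at K x (range (p x))"
  shows "K closure_of range (op_point K p) = topspace K"
proof (rule ccontr)
  let ?D = "range (op_point K p)"
  assume "K closure_of ?D \<noteq> topspace K"
  then obtain x where x: "x \<in> topspace K - K closure_of ?D"
    using closure_of_subset_topspace[of K ?D] by blast
  have D: "?D \<subseteq> topspace K" using op_point_in[OF K(3)] by auto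
  note \<mu>D = radon_measure_onD[OF \<mu>]
  interpret \<mu>: finite_measure \<mu> by (rule \<mu>D)
  have "regular_space K" by (intro compact_Hausdorff_imp_regular_space K)
  then obtain U V where UV: "openin K U" "openin K V" "x \<in> U" "K closure_of ?D \<subseteq> V" "disjnt U V"
    unfolding regular_space_def using x closedin_closure_of by metis
  have DV: "?D \<subseteq> V" using UV(4) closure_of_subset[OF D] by auto
  define W where "W s = (\<Union>n. p (op_point K p (fst (s n))) (snd (s n)))" for s :: "nat \<Rightarrow> op_tree \<times> nat set"
  define S where "S = {s. W s \<subseteq> V}"
  have pt: "\<exists>i. p (op_point K p t) i \<subseteq> Y" if "openin K Y" "op_point K p t \<in> Y" for t Y
    using p[OF op_point_in[OF K(3)]] that unfolding pi_base_at_def by blast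
  have pop: "openin K (p (op_point K p t) i)" "p (op_point K p t) i \<noteq> {}" for t i
    using p[OF op_point_in[OF K(3), of p t]] unfolding pi_base_at_def by auto
  have Wop: "openin K (W s)" for s unfolding W_def using pop by blast
  have Wm: "W s \<in> sets \<mu>" for s by (rule \<mu>D(3)[OF Wop])
  obtain i0 where "p (op_point K p Leaf) i0 \<subseteq> V" using pt[OF UV(2)] DV by blast
  then have "(\<lambda>_. (Leaf, i0)) \<in> S" by (auto simp: S_def W_def)
  then have "S \<noteq> {}" by blast
  from ennreal_SUP_countable_SUP[OF this, of "\<lambda>s. emeasure \<mu> (W s)"]
  obtain F :: "nat \<Rightarrow> ennreal" where F: "range F \<subseteq> (\<lambda>s. emeasure \<mu> (W s)) ` S" "(SUP s\<in>S. emeasure \<mu> (W s)) = Sup (range F)"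
    by blast
  have "\<forall>n. \<exists>s. s \<in> S \<and> F n = emeasure \<mu> (W s)" using F(1) by blast
  from choice[OF this] obtain s where s: "\<And>n. s n \<in> S" "\<And>n. F n = emeasure \<mu> (W (s n))" by blast
  \<comment> \<open>A sequence of unions approaching the supremum is merged into a single countable
    union by the pairing function, so the supremum is attained.\<close>
  define t where "t m = (case prod_decode m of (n, k) \<Rightarrow> s n k)" for m
  have "p (op_point K p (fst (s n k))) (snd (s n k)) \<subseteq> W t" for n k
    using UN_upper[of "prod_encode (n, k)" UNIV "\<lambda>n. p (op_point K p (fst (t n))) (snd (t n))"]
    by (simp add: W_def t_def)
  then have Wst: "W (s n) \<subseteq> W t" for n unfolding W_def[of "s n"] by blast
  have "p (op_point K p (fst (t m))) (snd (t m)) \<subseteq> V" for m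
  proof -
    obtain n k where nk: "prod_decode m = (n, k)" by (cases "prod_decode m")
    have "W (s n) \<subseteq> V" using s(1)[of n] by (simp add: S_def)
    then show ?thesis unfolding W_def t_def nk prod.case by blast
  qed
  then have tS: "t \<in> S" unfolding S_def W_def by blast
  have max: "emeasure \<mu> (W s') \<le> emeasure \<mu> (W t)" if "s' \<in> S" for s'
  proof -
    have "emeasure \<mu> (W s') \<le> Sup (range F)" unfolding F(2)[symmetric] using that by (rule SUP_upper)
    also have "\<dots> \<le> emeasure \<mu> (W t)"
      unfolding s(2) by (rule SUP_least) (intro emeasure_mono Wst Wm)
    finally show ?thesis .
  qed
  have "W t \<subseteq> V" using tS by (simp add: S_def)
  then have "x \<notin> K closure_of W t"
    using UV(1,3,5) unfolding in_closure_of disjnt_def by blast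
  then have "K closure_of W t \<noteq> topspace K" using x by blast
  then obtain e where e: "op_point K p e \<notin> K closure_of W t" "op_point K p e \<in> topspace K"
    using op_point_Node[OF K(3), of p "\<lambda>n. fst (t n)" "\<lambda>n. snd (t n)"] unfolding W_def by blast
  have "openin K ((topspace K - K closure_of W t) \<inter> V)"
    by (intro openin_Int openin_diff UV) auto
  then obtain i where i: "p (op_point K p e) i \<subseteq> (topspace K - K closure_of W t) \<inter> V"
    using pt[of "(topspace K - K closure_of W t) \<inter> V" e] e DV by blast
  let ?P = "p (op_point K p e) i"
  \<comment> \<open>Prepending the new member to the sequence keeps the union countable and inside
    V, in conflict with maximality.\<close>
  have "W (case_nat (e, i) t) = ?P \<union> W t"
    unfolding W_def by (subst UNIV_nat_eq) (simp add: image_image)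
  moreover have "?P \<inter> W t = {}"
    using i closure_of_subset[of "W t" K] openin_subset[OF Wop, of t] by blast
  moreover have Pm: "?P \<in> sets \<mu>" by (intro \<mu>D pop)
  ultimately have sum: "emeasure \<mu> (W (case_nat (e, i) t)) = emeasure \<mu> ?P + emeasure \<mu> (W t)"
    using plus_emeasure[OF Pm Wm] by simp
  have "emeasure \<mu> ?P > 0" by (intro pos pop)
  have "case_nat (e, i) t \<in> S"
    using \<open>W (case_nat (e, i) t) = ?P \<union> W t\<close> i tS by (auto simp: S_def)
  from max[OF this] have "emeasure \<mu> (W t) + emeasure \<mu> ?P \<le> emeasure \<mu> (W t) + 0"
    unfolding sum by (simp only: add.commute[of "emeasure \<mu> ?P"] add_0_right)
  then have "emeasure \<mu> ?P \<le> 0"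
    unfolding ennreal_add_left_cancel_le using \<mu>.emeasure_finite by auto
  then show False using \<open>emeasure \<mu> ?P > 0\<close> by simp
qed

subsection \<open>Density points and non-null sets of reals\<close>

text \<open>Base 3 with digits 0 and 1 avoids the double expansions of base 2: every tail is at most
  1/2, so no carry occurs and each digit can be read off by floors.\<close>

definition ternary_value :: "(nat \<Rightarrow> bool) \<Rightarrow> real" where
  "ternary_value b = (\<Sum>n. of_bool (b n) * (1/3) ^ Suc n)"

lemma geometric_third: "(\<lambda>n. (1/3 :: real) ^ Suc n) sums (1/2)"
  using sums_mult[OF geometric_sums[of "1/3 :: real"], of "1/3"] by simp

lemma summable_ternary: "summable (\<lambda>n. of_bool (b n) * (1/3 :: real) ^ Suc n)"
  by (rule summable_comparison_test'[OF sums_summable[OF geometric_third], of 0]) auto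

lemma ternary_value_bounds: "0 \<le> ternary_value b" "ternary_value b \<le> 1/2"
proof -
  show "0 \<le> ternary_value b"
    unfolding ternary_value_def by (intro suminf_nonneg summable_ternary) auto
  have "ternary_value b \<le> (\<Sum>n. (1/3) ^ Suc n)"
    unfolding ternary_value_def
    by (intro suminf_le summable_ternary sums_summable[OF geometric_third]) auto
  also have "\<dots> = 1/2" using geometric_third by (simp add: sums_iff)
  finally show "ternary_value b \<le> 1/2" .
qed

lemma ternary_value_shift: "3 * ternary_value b = of_bool (b 0) + ternary_value (\<lambda>n. b (Suc n))"
proof -
  have "ternary_value b = of_bool (b 0) / 3 + (\<Sum>n. of_bool (b (Suc n)) * (1/3) ^ Suc (Suc n))"
    unfolding ternary_value_def using suminf_split_head[OF summable_ternary, of b] by simp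
  also have "(\<Sum>n. of_bool (b (Suc n)) * (1/3 :: real) ^ Suc (Suc n)) = ternary_value (\<lambda>n. b (Suc n)) / 3"
    unfolding ternary_value_def
    by (subst suminf_divide[OF summable_ternary, symmetric]) (simp add: field_simps)
  finally show ?thesis by simp
qed

lemma ternary_digit:
  "\<lfloor>3 ^ Suc n * ternary_value b\<rfloor> - 3 * \<lfloor>3 ^ n * ternary_value b\<rfloor> = of_bool (b n)"
proof -
  have "\<exists>m::int. 3 ^ n * ternary_value b = of_int m + ternary_value (\<lambda>k. b (n + k))" for n
  proof (induction n)
    case 0
    show ?case by (rule exI[of _ 0]) simp
  next
    case (Suc n)
    then obtain m :: int where m: "3 ^ n * ternary_value b = of_int m + ternary_value (\<lambda>k. b (n + k))" ..
    have "3 ^ Suc n * ternary_value b = of_int (3 * m + of_bool (b n)) + ternary_value (\<lambda>k. b (Suc n + k))"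
      using m ternary_value_shift[of "\<lambda>k. b (n + k)"] by simp
    then show ?case by blast
  qed
  then obtain m :: int where m: "3 ^ n * ternary_value b = of_int m + ternary_value (\<lambda>k. b (n + k))" by blast
  have m': "3 ^ Suc n * ternary_value b = of_int (3 * m + of_bool (b n)) + ternary_value (\<lambda>k. b (Suc n + k))"
    using m ternary_value_shift[of "\<lambda>k. b (n + k)"] by simp
  have "\<lfloor>3 ^ n * ternary_value b\<rfloor> = m"
    unfolding m using ternary_value_bounds[of "\<lambda>k. b (n + k)"] by (intro floor_unique) auto
  moreover have "\<lfloor>3 ^ Suc n * ternary_value b\<rfloor> = 3 * m + of_bool (b n)"
    unfolding m' using ternary_value_bounds[of "\<lambda>k. b (Suc n + k)"] by (intro floor_unique) auto
  ultimately show ?thesis by simp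
qed

text \<open>This is Marczewski's characteristic function: digit n of \<open>X x\<close> tells
  whether x lies in the n-th generator. Each generator is the preimage of the Borel set of reals
  with that digit 1, and preimages of Borel sets form a sigma-algebra. The empty set is added to the
  family only to have something to enumerate.\<close>

lemma countable_family_generated_by_real:
  assumes "countable \<G>" "\<G> \<subseteq> sets M"
  obtains X :: "'a \<Rightarrow> real" where "X \<in> borel_measurable M"
    "\<And>T. T \<in> sigma_sets (space M) \<G> \<Longrightarrow> \<exists>S\<in>sets borel. T = X -` S \<inter> space M"
proof -
  define G where "G = from_nat_into (insert {} \<G>)"
  have G: "range G = insert {} \<G>"
    unfolding G_def by (rule range_from_nat_into) (use assms in auto)
  define X where "X x = ternary_value (\<lambda>n. x \<in> G n)" for x
  have Gm[measurable]: "G n \<in> sets M" for n using G assms(2) by (metis insert_subset range_subsetD sets.empty_sets)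
  have Xm: "X \<in> borel_measurable M" unfolding X_def ternary_value_def by measurable
  define D where "D n = {y :: real. \<lfloor>3 ^ Suc n * y\<rfloor> - 3 * \<lfloor>3 ^ n * y\<rfloor> = 1}" for n
  have D: "D n \<in> sets borel" for n
  proof -
    have [measurable]: "(\<lambda>y::real. \<lfloor>3 ^ Suc n * y\<rfloor> - 3 * \<lfloor>3 ^ n * y\<rfloor>) \<in> measurable borel (count_space UNIV)"
      by measurable
    show ?thesis unfolding D_def by measurable
  qed
  have GX: "G n = X -` D n \<inter> space M" for n
  proof -
    have "X x \<in> D n \<longleftrightarrow> x \<in> G n" for x
      unfolding D_def X_def mem_Collect_eq ternary_digit by simp
    then show ?thesis using sets.sets_into_space[OF Gm[of n]] by auto
  qed
  show ?thesis
  proof (rule that[OF Xm])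
    fix T assume "T \<in> sigma_sets (space M) \<G>"
    then show "\<exists>S\<in>sets borel. T = X -` S \<inter> space M"
    proof induction
      case (Basic T)
      then obtain n where "T = G n" using G by (metis imageE insertCI)
      then show ?case using GX D by blast
    next
      case Empty
      then show ?case by (intro bexI[of _ "{}"]) auto
    next
      case (Compl T)
      then obtain S where S: "S \<in> sets borel" "T = X -` S \<inter> space M" by blast
      then show ?case by (intro bexI[of _ "- S"]) auto
    next
      case (Union T)
      then have "\<forall>i. \<exists>S. S \<in> sets borel \<and> T i = X -` S \<inter> space M" by blast
      from choice[OF this] obtain S where "\<And>i. S i \<in> sets borel" "\<And>i. T i = X -` S i \<inter> space M" by blast
      then show ?case by (intro bexI[of _ "\<Union>i. S i"]) auto
    qed
  qed
qed

section \<open>Lebesgue density from the right\<close>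

text \<open>Intervals starting at x fit the differentiation theorem for cubes with corner x, and one
  side is enough for intersecting finitely many sets near a common point. Membership of x in
  \<open>T\<close> is not demanded.\<close>

definition right_density_point :: "real \<Rightarrow> real set \<Rightarrow> bool" where
  "right_density_point x T \<longleftrightarrow>
    (\<forall>e>0. \<exists>d>0. \<forall>h. 0 < h \<longrightarrow> h < d \<longrightarrow> measure lborel ({x..x+h} - T) \<le> e * h)"

text \<open>Lebesgue's differentiation theorem for the indicator function of \<open>T\<close>, whose
  averages over short intervals tend to 1 at almost every point of \<open>T\<close>.\<close>

lemma AE_right_density_point:
  assumes T: "T \<in> sets borel"
  shows "AE x in lborel. x \<in> T \<longrightarrow> right_density_point x T"
proof -
  have int: "(\<lambda>x. indicator T x :: real) integrable_on cbox a b" and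
    I: "integral (cbox a b) (\<lambda>x. indicator T x :: real) = measure lborel (T \<inter> cbox a b)" for a b
  proof -
    have "T \<inter> cbox a b \<in> lmeasurable"
      using T by (intro bounded_set_imp_lmeasurable) (auto intro: sets_completionI_sets)
    then have "((indicator (T \<inter> cbox a b) :: real \<Rightarrow> real) has_integral measure lebesgue (T \<inter> cbox a b)) UNIV"
      by (simp add: lmeasurable_iff_has_integral)
    then have *: "(indicator (T \<inter> cbox a b) :: real \<Rightarrow> real) integrable_on UNIV"
      "integral UNIV (indicator (T \<inter> cbox a b) :: real \<Rightarrow> real) = measure lebesgue (T \<inter> cbox a b)"
      by (auto intro: integral_unique)
    have r: "(\<lambda>x. if x \<in> cbox a b then indicator T x :: real else 0) = indicator (T \<inter> cbox a b)"
      by (auto simp: indicator_def fun_eq_iff)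
    show "(\<lambda>x. indicator T x :: real) integrable_on cbox a b"
      using * by (subst integrable_restrict_UNIV[symmetric]) (simp only: r)
    show "integral (cbox a b) (\<lambda>x. indicator T x :: real) = measure lborel (T \<inter> cbox a b)"
      using * T by (subst integral_restrict_UNIV[symmetric]) (simp only: r measure_completion sets.Int sets_lborel borel_closed closed_cbox)
  qed
  obtain N where N: "negligible N" "\<And>x e. \<lbrakk>x \<notin> N; 0 < e\<rbrakk> \<Longrightarrow>
     \<exists>d>0. \<forall>h. 0 < h \<and> h < d \<longrightarrow>
       norm (integral (cbox x (x + h *\<^sub>R One)) (\<lambda>x. indicator T x :: real) /\<^sub>R h ^ DIM(real) - indicator T x) < e"
    using integrable_ccontinuous_explicit[OF int] by metis
  have "right_density_point x T" if x: "x \<notin> N" "x \<in> T" for x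
    unfolding right_density_point_def
  proof (intro allI impI)
    fix e :: real assume "e > 0"
    from N(2)[OF x(1) this] obtain d where d: "d > 0"
      "\<And>h. 0 < h \<Longrightarrow> h < d \<Longrightarrow> \<bar>measure lborel (T \<inter> {x..x+h}) / h - 1\<bar> < e"
      using x(2) unfolding I by (auto simp: cbox_interval divide_inverse mult.commute)
    have "measure lborel ({x..x+h} - T) \<le> e * h" if h: "0 < h" "h < d" for h
    proof -
      have "{x..x+h} - T = {x..x+h} - (T \<inter> {x..x+h})" by auto
      then have "measure lborel ({x..x+h} - T) = measure lborel {x..x+h} - measure lborel (T \<inter> {x..x+h})"
        using T h by (simp only:) (rule measure_Diff, auto)
      also have "\<dots> = h - measure lborel (T \<inter> {x..x+h})" using h by simp
      also have "\<dots> \<le> e * h" using d(2)[OF h] h by (simp add: abs_less_iff field_simps)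
      finally show ?thesis .
    qed
    then show "\<exists>d>0. \<forall>h. 0 < h \<longrightarrow> h < d \<longrightarrow> measure lborel ({x..x+h} - T) \<le> e * h"
      using d(1) by blast
  qed
  then have "{x. \<not> (x \<in> T \<longrightarrow> right_density_point x T)} \<subseteq> N" by auto
  then have "AE x in lebesgue. x \<in> T \<longrightarrow> right_density_point x T"
    using N(1) by (intro AE_I'[of N]) (auto simp: negligible_iff_null_sets)
  then show ?thesis by (simp add: AE_completion_iff)
qed

lemma right_density_point_Inter_positive:
  assumes F: "finite F" and T: "\<And>T. T \<in> F \<Longrightarrow> T \<in> sets borel" "\<And>T. T \<in> F \<Longrightarrow> right_density_point x T"
  shows "emeasure lborel (\<Inter>F) > 0"
proof -
  \<comment> \<open>On a short interval each set misses at most the fraction 1 / (card F + 1), so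
    all of them together miss less than the whole; the added 1 gives strictness and covers the empty
    family.\<close>
  define e :: real where "e = 1 / (card F + 1)"
  have e: "e > 0" by (simp add: e_def)
  have "\<exists>d>0. \<forall>h. 0 < h \<longrightarrow> h < d \<longrightarrow> (\<forall>T\<in>F. measure lborel ({x..x+h} - T) \<le> e * h)"
    using F T(2)
  proof (induction F rule: finite_induct)
    case empty
    then show ?case by (intro exI[of _ 1]) auto
  next
    case (insert T F)
    then obtain d where d: "d > 0" "\<forall>h. 0 < h \<longrightarrow> h < d \<longrightarrow> (\<forall>T\<in>F. measure lborel ({x..x+h} - T) \<le> e * h)"
      by auto
    obtain d' where d': "d' > 0" "\<forall>h. 0 < h \<longrightarrow> h < d' \<longrightarrow> measure lborel ({x..x+h} - T) \<le> e * h"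
      using insert.prems[of T] e unfolding right_density_point_def by blast
    show ?case using d d' by (intro exI[of _ "min d d'"]) auto
  qed
  then obtain d where d: "d > 0" "\<And>h T. 0 < h \<Longrightarrow> h < d \<Longrightarrow> T \<in> F \<Longrightarrow> measure lborel ({x..x+h} - T) \<le> e * h" by blast
  define h where "h = d / 2"
  have h: "0 < h" "h < d" using d by (auto simp: h_def)
  have Im: "\<Inter>F \<in> sets borel" using F T(1) by (induction F) auto
  have "measure lborel ({x..x+h} - \<Inter>F) = measure lborel (\<Union>T\<in>F. {x..x+h} - T)" by (intro arg_cong[where f="measure lborel"]) auto
  also have "\<dots> \<le> (\<Sum>T\<in>F. measure lborel ({x..x+h} - T))"
    using F T(1) h by (intro measure_UNION_le) auto
  also have "\<dots> \<le> (\<Sum>T\<in>F. e * h)" by (intro sum_mono d h)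
  also have "\<dots> = card F * e * h" by simp
  also have "\<dots> < h" using h by (simp add: e_def field_simps)
  finally have lt: "measure lborel ({x..x+h} - \<Inter>F) < h" .
  show ?thesis
  proof (rule ccontr)
    assume "\<not> ?thesis"
    then have "\<Inter>F \<in> null_sets lborel" using Im by auto
    then have "measure lborel ({x..x+h} - \<Inter>F) = measure lborel {x..x+h}"
      by (intro measure_Diff_null_set) auto
    with lt h show False by simp
  qed
qed

text \<open>Splitting each element of \<open>B\<close> into countably many independent uniform reals turns a merely
  non-null set into one that meets every set of positive measure.\<close>

definition sample_points :: "(nat \<Rightarrow> bool) set \<Rightarrow> real set" where
  "sample_points B = (\<lambda>(n, b). binary_value (\<lambda>k. b (prod_encode (n, k)))) ` (UNIV \<times> B)"

text \<open>Otherwise \<open>B\<close> would lie in the preimage of the null set of sequences of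
  uniform reals that never enter \<open>T\<close>. Independent uniform reals come from the rows of
  the coin sequence under the pairing function.\<close>

lemma sample_points_hit:
  assumes B: "\<And>N. N \<in> null_sets (coins UNIV) \<Longrightarrow> \<not> B \<subseteq> N"
    and T: "T \<in> sets borel" "emeasure unit_measure T > 0"
  shows "sample_points B \<inter> T \<noteq> {}"
proof -
  let ?P = "PiM (UNIV :: nat set) (\<lambda>_. unit_measure)"
  have bm: "binary_value \<in> measurable (coins UNIV) unit_measure"
    using measurable_binary_value by (simp cong: measurable_cong_sets)
  have bd: "distr (coins UNIV) unit_measure binary_value = unit_measure"
    unfolding distr_binary_value[symmetric] by (rule distr_cong) auto
  define Y where "Y b = (\<lambda>n\<in>(UNIV :: nat set). binary_value (\<lambda>k\<in>(UNIV :: nat set). b (prod_encode (n, k))))" for b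
  have "distr (coins UNIV) ?P Y = PiM UNIV (\<lambda>_. distr (coins UNIV) unit_measure binary_value)"
    unfolding Y_def[abs_def] by (rule distr_PiM_blocks[OF prob_space_coin]) (use bm inj_prod_encode in \<open>auto intro: inj_on_subset\<close>)
  then have Y: "distr (coins UNIV) ?P Y = ?P" by (simp only: bd)
  have Ym: "Y \<in> measurable (coins UNIV) ?P"
    unfolding Y_def[abs_def]
    by (intro measurable_restrict measurable_compose[OF _ bm] measurable_component_singleton) auto
  have "{w \<in> space ?P. \<forall>n. w n \<notin> T} \<in> null_sets ?P"
    using T by (intro null_sets_PiM_never_in prob_space_unit_measure) auto
  then have "Y -` {w \<in> space ?P. \<forall>n. w n \<notin> T} \<inter> space (coins UNIV) \<in> null_sets (coins UNIV)"
    using null_sets_distr_iff[OF Ym] unfolding Y by simp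
  from B[OF this] obtain b where "b \<in> B" "\<not> (\<forall>n. Y b n \<notin> T)" by (auto simp: space_PiM space_uniform_count_measure)
  then obtain n where n: "Y b n \<in> T" by blast
  have "Y b n = binary_value (\<lambda>k. b (prod_encode (n, k)))" by (simp add: Y_def restrict_def)
  then have "Y b n \<in> sample_points B"
    unfolding sample_points_def using \<open>b \<in> B\<close> by (intro image_eqI[of _ _ "(n, b)"]) auto
  with n show ?thesis by blast
qed

text \<open>The class of \<open>T\<close> is a density point of the copy of \<open>T\<close> in the unit interval under the
  quantile transform; sets sharing a density point have intersections of positive measure.\<close>

lemma centered_classes:
  assumes B: "\<And>N. N \<in> null_sets (coins UNIV) \<Longrightarrow> \<not> B \<subseteq> N"
    and M: "prob_space M" and \<G>: "countable \<G>" "\<G> \<subseteq> sets M"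
  obtains z :: "'a set \<Rightarrow> real" where
    "\<And>T. T \<in> sigma_sets (space M) \<G> \<Longrightarrow> emeasure M T > 0 \<Longrightarrow> z T \<in> sample_points B"
    "\<And>F c. finite F \<Longrightarrow> F \<subseteq> sigma_sets (space M) \<G> \<Longrightarrow> \<forall>T\<in>F. emeasure M T > 0 \<and> z T = c \<Longrightarrow>
      emeasure M {x \<in> space M. \<forall>T\<in>F. x \<in> T} > 0"
proof -
  obtain X :: "'a \<Rightarrow> real" where X[measurable]: "X \<in> borel_measurable M"
    and XS: "\<And>T. T \<in> sigma_sets (space M) \<G> \<Longrightarrow> \<exists>S\<in>sets borel. T = X -` S \<inter> space M"
    using countable_family_generated_by_real[OF \<G>] by blast
  interpret M: prob_space M by fact
  define \<nu> where "\<nu> = distr M borel X"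
  interpret \<nu>: real_distribution \<nu> unfolding \<nu>_def by (rule M.real_distribution_distr) (rule X)
  interpret Q: cdf_distribution \<nu> ..
  let ?L = "restrict_space lborel {0<..<1::real}"
  define S where "S T = (SOME S. S \<in> sets borel \<and> T = X -` S \<inter> space M)" for T
  have S: "S T \<in> sets borel" "T = X -` S T \<inter> space M" if "T \<in> sigma_sets (space M) \<G>" for T
    using someI_ex[of "\<lambda>S. S \<in> sets borel \<and> T = X -` S \<inter> space M"] XS[OF that] unfolding S_def by blast+
  \<comment> \<open>\<open>Q.I\<close> is the quantile function of the law of \<open>X\<close> and
    carries Lebesgue measure on the open unit interval to that law. So \<open>R T\<close> is a Borel
    copy of \<open>T\<close> with the same measure, even if the law has atoms.\<close>
  define R where "R T = Q.I -` S T \<inter> {0<..<1}" for T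
  have pull: "Q.I -` A \<inter> {0<..<1} \<in> sets borel" "emeasure lborel (Q.I -` A \<inter> {0<..<1}) = emeasure M (X -` A \<inter> space M)"
    if A: "A \<in> sets borel" for A
  proof -
    have "Q.I -` A \<inter> space ?L \<in> sets ?L"
      using measurable_sets[OF Q.measurable_CI A] by (simp add: space_restrict_space sets_restrict_space)
    then show s: "Q.I -` A \<inter> {0<..<1} \<in> sets borel"
      by (simp add: space_restrict_space sets_restrict_space_iff)
    have "emeasure M (X -` A \<inter> space M) = emeasure \<nu> A" unfolding \<nu>_def using A by (simp add: emeasure_distr)
    also have "\<dots> = emeasure (distr ?L borel Q.I) A" by (simp only: Q.distr_I_eq_M)
    also have "\<dots> = emeasure ?L (Q.I -` A \<inter> space ?L)"
      using Q.measurable_CI A by (intro emeasure_distr) (simp cong: measurable_cong_sets add: sets_restrict_space)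
    also have "\<dots> = emeasure lborel (Q.I -` A \<inter> {0<..<1})"
      by (simp add: space_restrict_space emeasure_restrict_space)
    finally show "emeasure lborel (Q.I -` A \<inter> {0<..<1}) = emeasure M (X -` A \<inter> space M)" by simp
  qed
  have R: "R T \<in> sets borel" "emeasure lborel (R T) = emeasure M T" if "T \<in> sigma_sets (space M) \<G>" for T
    using pull[OF S(1)[OF that]] S(2)[OF that] unfolding R_def by auto
  \<comment> \<open>The points of \<open>R T\<close> that are not density points are removed along
    with a null set N. What remains still has positive measure, so the samples meet it.\<close>
  have "\<exists>z\<in>sample_points B. right_density_point z (R T)" if T: "T \<in> sigma_sets (space M) \<G>" "emeasure M T > 0" for T
  proof -
    obtain N where N: "N \<in> null_sets lborel" "{x. \<not> (x \<in> R T \<longrightarrow> right_density_point x (R T))} \<subseteq> N"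
      using AE_right_density_point[OF R(1)[OF T(1)]] by (auto elim!: AE_E3 simp: eventually_ae_filter)
    have "emeasure lborel (R T - N) = emeasure lborel (R T)"
      using N(1) R(1)[OF T(1)] by (intro emeasure_Diff_null_set) auto
    moreover have "{0..1} \<inter> (R T - N) = R T - N" by (auto simp: R_def)
    ultimately have "emeasure unit_measure (R T - N) > 0"
      using T R[OF T(1)] N(1) by (subst emeasure_uniform_measure) (auto simp: divide_ennreal_def)
    then have "sample_points B \<inter> (R T - N) \<noteq> {}"
      using R(1)[OF T(1)] N(1) by (intro sample_points_hit B) auto
    then show ?thesis using N(2) by blast
  qed
  then have "\<forall>T. \<exists>z. T \<in> sigma_sets (space M) \<G> \<and> emeasure M T > 0 \<longrightarrow> z \<in> sample_points B \<and> right_density_point z (R T)"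
    by blast
  from choice[OF this] obtain z where
    z: "\<And>T. T \<in> sigma_sets (space M) \<G> \<Longrightarrow> emeasure M T > 0 \<Longrightarrow> z T \<in> sample_points B \<and> right_density_point (z T) (R T)"
    by blast
  show ?thesis
  proof (rule that[of z])
    fix F c assume F: "finite F" "F \<subseteq> sigma_sets (space M) \<G>" "\<forall>T\<in>F. emeasure M T > 0 \<and> z T = c"
    show "emeasure M {x \<in> space M. \<forall>T\<in>F. x \<in> T} > 0"
    \<comment> \<open>An empty intersection would be the whole line instead of a part of the unit
      interval, so this case is separate.\<close>
    proof (cases "F = {}")
      case True
      then show ?thesis using M.emeasure_space_1 by simp
    next
      case False
      have "emeasure lborel (\<Inter>(R ` F)) > 0"
      proof (rule right_density_point_Inter_positive)
        fix A assume "A \<in> R ` F"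
        then obtain T where T: "T \<in> F" "A = R T" by blast
        then have "right_density_point (z T) (R T)" using F(2,3) z[of T] by blast
        then show "right_density_point c A" using F(3) T by simp
      qed (use F R in auto)
      also have "\<Inter>(R ` F) = Q.I -` (\<Inter>T\<in>F. S T) \<inter> {0<..<1}"
        using False by (auto simp: R_def)
      also have "emeasure lborel \<dots> = emeasure M (X -` (\<Inter>T\<in>F. S T) \<inter> space M)"
        using F(1,2) S(1) False by (intro pull sets.finite_INT) auto
      also have "X -` (\<Inter>T\<in>F. S T) \<inter> space M = {x \<in> space M. \<forall>T\<in>F. x \<in> T}"
      proof -
        have "x \<in> T \<longleftrightarrow> X x \<in> S T" if "x \<in> space M" "T \<in> F" for x T
          using S(2)[of T] that F(2) by blast
        then show ?thesis by auto
      qed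
      finally show ?thesis .
    qed
  qed (use z in auto)
qed

subsection \<open>Countable sets of ordinals below \<open>\<omega>\<^sub>2\<close>\<close>

definition unbounded_in :: "'b rel \<Rightarrow> 'b set \<Rightarrow> bool" where
  "unbounded_in r S \<longleftrightarrow> (\<forall>\<beta>\<in>Field r. \<exists>\<alpha>\<in>S. \<beta> \<in> underS r \<alpha>)"

lemma Card_order_rels:
  assumes "Card_order r"
  shows "trans r" "antisym r" "wf (r - Id)" "well_order_on (Field r) r"
    "\<And>a b. a \<in> Field r \<Longrightarrow> b \<in> Field r \<Longrightarrow> a \<notin> underS r b \<Longrightarrow> (b, a) \<in> r"
proof -
  show w: "well_order_on (Field r) r" using assms by (simp add: card_order_on_well_order_on)
  then show "trans r" "antisym r" "wf (r - Id)" by (auto simp: order_on_defs)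
  show "(b, a) \<in> r" if "a \<in> Field r" "b \<in> Field r" "a \<notin> underS r b" for a b
    using w that by (cases "a = b") (auto simp: order_on_defs refl_on_def total_on_def underS_def)
qed

lemma underS_rel_trans:
  assumes "trans r" "antisym r" "a \<in> underS r b" "(b, c) \<in> r"
  shows "a \<in> underS r c"
proof -
  have ab: "(a, b) \<in> r" "a \<noteq> b" using assms(3) by (auto simp: underS_def)
  have "(a, c) \<in> r" using assms(1) ab(1) assms(4) by (rule transD)
  moreover have "a \<noteq> c" using antisymD[OF assms(2) ab(1)] assms(4) ab(2) by blast
  ultimately show ?thesis by (simp add: underS_def)
qed

lemma rel_underS_trans:
  assumes "trans r" "antisym r" "(a, b) \<in> r" "b \<in> underS r c"
  shows "a \<in> underS r c"
proof -
  have bc: "(b, c) \<in> r" "b \<noteq> c" using assms(4) by (auto simp: underS_def)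
  have "(a, c) \<in> r" using assms(1,3) bc(1) by (rule transD)
  moreover have "a \<noteq> c" using antisymD[OF assms(2) assms(3)] bc by blast
  ultimately show ?thesis by (simp add: underS_def)
qed

lemma underS_trans: "trans r \<Longrightarrow> antisym r \<Longrightarrow> a \<in> underS r b \<Longrightarrow> b \<in> underS r c \<Longrightarrow> a \<in> underS r c"
  by (rule underS_rel_trans) (auto simp: underS_def)

lemma underS_relChain: "Card_order r \<Longrightarrow> relChain r (underS r)"
  unfolding relChain_def by (blast intro: underS_rel_trans Card_order_rels(1,2))

lemma underS_in_Field: "a \<in> underS r b \<Longrightarrow> a \<in> Field r" "a \<in> underS r b \<Longrightarrow> b \<in> Field r"
  by (auto simp: underS_def Field_def)

section \<open>Regularity of successor cardinals\<close>

locale card_successor =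
  fixes \<kappa> :: "'c rel"
  assumes \<kappa>: "Card_order \<kappa>" "infinite (Field \<kappa>)"
begin

abbreviation (input) "r \<equiv> cardSuc \<kappa>"

lemma r: "Card_order r" "infinite (Field r)"
  using \<kappa> by (auto simp: cardSuc_Card_order cardSuc_finite)

text \<open>Regularity of the successor of \<kappa>, in the form used for both
  \<open>\<omega>\<^sub>1\<close> and \<open>\<omega>\<^sub>2\<close>: a set of size at most
  \<kappa> cannot be cofinal in a chain of that length.\<close>

lemma chain_absorbs:
  assumes "relChain r As" "B \<subseteq> (\<Union>i\<in>Field r. As i)" "|B| \<le>o \<kappa>"
  shows "\<exists>i\<in>Field r. B \<subseteq> As i"
  using cardSuc_UNION[OF \<kappa> assms] .

lemma exists_above:
  assumes "a \<in> Field r" obtains b where "b \<in> Field r" "a \<in> underS r b"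
proof -
  obtain b where "b \<in> Field r" "a \<noteq> b" "(a, b) \<in> r"
    using infinite_Card_order_limit[OF r assms] by blast
  then show thesis by (intro that[of b]) (simp_all add: underS_def)
qed

lemma small_set_bounded:
  assumes "A \<subseteq> Field r" "|A| \<le>o \<kappa>"
  shows "\<exists>\<beta>\<in>Field r. A \<subseteq> underS r \<beta>"
proof (rule chain_absorbs)
  show "relChain r (underS r)" by (rule underS_relChain[OF r(1)])
  show "A \<subseteq> (\<Union>i\<in>Field r. underS r i)" using assms(1) exists_above by blast
qed fact

lemma card_underS:
  assumes "a \<in> Field r"
  shows "|underS r a| \<le>o \<kappa>"
  using card_of_underS[OF r(1) assms]
  unfolding cardSuc_ordLeq_ordLess[OF \<kappa>(1) card_of_Card_order] .

text \<open>If each class z were bounded, by \<open>b z\<close>, then by regularity the at most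
  \<kappa> many bounds would lie below one \<beta>, and no element of \<open>S\<close> could lie
  above \<beta>.\<close>

lemma pigeonhole:
  assumes S: "S \<subseteq> Field r" "unbounded_in r S" and f: "f ` S \<subseteq> Z" "|Z| \<le>o \<kappa>"
  shows "\<exists>z\<in>Z. unbounded_in r {\<alpha> \<in> S. f \<alpha> = z}"
proof (rule ccontr)
  assume "\<not> ?thesis"
  then have "\<forall>z\<in>Z. \<exists>\<beta>. \<beta> \<in> Field r \<and> (\<forall>\<alpha>\<in>S. f \<alpha> = z \<longrightarrow> \<beta> \<notin> underS r \<alpha>)"
    unfolding unbounded_in_def by blast
  from bchoice[OF this] obtain b where b: "\<forall>z\<in>Z. b z \<in> Field r \<and> (\<forall>\<alpha>\<in>S. f \<alpha> = z \<longrightarrow> b z \<notin> underS r \<alpha>)" ..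
  have "|b ` Z| \<le>o \<kappa>" using card_of_image f(2) ordLeq_transitive by blast
  then obtain \<beta> where \<beta>: "\<beta> \<in> Field r" "b ` Z \<subseteq> underS r \<beta>"
    using small_set_bounded[of "b ` Z"] b by blast
  obtain \<alpha> where \<alpha>: "\<alpha> \<in> S" "\<beta> \<in> underS r \<alpha>" using S(2) \<beta>(1) unfolding unbounded_in_def by blast
  have "b (f \<alpha>) \<in> underS r \<beta>" using \<beta>(2) \<alpha>(1) f(1) by blast
  then have "b (f \<alpha>) \<in> underS r \<alpha>"
    using \<alpha>(2) by (rule underS_trans[OF Card_order_rels(1,2)[OF r(1)]])
  moreover have "f \<alpha> \<in> Z" using \<alpha>(1) f(1) by blast
  ultimately show False using b \<alpha>(1) by blast
qed

end

lemma card_successor_natLeq: "card_successor natLeq"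
proof
  show "Card_order natLeq" by (rule natLeq_Card_order)
qed (simp add: Field_natLeq)

lemma card_successor_omega1: "card_successor \<omega>\<^sub>1"
  using card_successor.r[OF card_successor_natLeq] by (simp add: card_successor_def)

interpretation o1: card_successor natLeq by (rule card_successor_natLeq)
interpretation o2: card_successor \<omega>\<^sub>1 by (rule card_successor_omega1)

lemma countable_imp_omega1: "countable A \<Longrightarrow> |A| \<le>o \<omega>\<^sub>1"
  unfolding countable_card_le_natLeq by (rule ordLeq_transitive[OF _ cardSuc_ordLeq[OF o1.\<kappa>(1)]])

text \<open>If every \<open>\<gamma>\<close> failed, say beyond \<open>g \<gamma>\<close>, one could iterate \<open>g\<close> along \<open>\<omega>\<^sub>1\<close>; the
  least upper bound \<open>\<alpha>\<close> of the iteration has cofinality \<open>\<omega>\<^sub>1\<close>, so the countable set \<open>C \<alpha>\<close> lies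
  below some stage, which is a contradiction.\<close>

lemma pressing_down:
  assumes C: "\<And>\<alpha>. \<alpha> \<in> Field \<omega>\<^sub>2 \<Longrightarrow> countable (C \<alpha>)" "\<And>\<alpha>. \<alpha> \<in> Field \<omega>\<^sub>2 \<Longrightarrow> C \<alpha> \<subseteq> underS \<omega>\<^sub>2 \<alpha>"
  shows "\<exists>\<gamma>\<in>Field \<omega>\<^sub>2. unbounded_in \<omega>\<^sub>2 {\<alpha> \<in> Field \<omega>\<^sub>2. C \<alpha> \<subseteq> underS \<omega>\<^sub>2 \<gamma>}"
proof (rule ccontr)
  let ?r = "\<omega>\<^sub>2" and ?s = "\<omega>\<^sub>1"
  note r = Card_order_rels[OF o2.r(1)] and s = Card_order_rels[OF o1.r(1)]
  assume "\<not> ?thesis"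
  then have "\<forall>\<gamma>\<in>Field ?r. \<exists>\<beta>. \<beta> \<in> Field ?r \<and> (\<forall>\<alpha>\<in>Field ?r. C \<alpha> \<subseteq> underS ?r \<gamma> \<longrightarrow> \<beta> \<notin> underS ?r \<alpha>)"
    unfolding unbounded_in_def by blast
  from bchoice[OF this] obtain g where
    g: "\<And>\<gamma>. \<gamma> \<in> Field ?r \<Longrightarrow> g \<gamma> \<in> Field ?r"
      "\<And>\<gamma> \<alpha>. \<gamma> \<in> Field ?r \<Longrightarrow> \<alpha> \<in> Field ?r \<Longrightarrow> C \<alpha> \<subseteq> underS ?r \<gamma> \<Longrightarrow> g \<gamma> \<notin> underS ?r \<alpha>"
    by blast
  define ub where "ub A = (SOME \<beta>. \<beta> \<in> Field ?r \<and> A \<subseteq> underS ?r \<beta>)" for A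
  have ub: "ub A \<in> Field ?r" "A \<subseteq> underS ?r (ub A)" if "A \<subseteq> Field ?r" "|A| \<le>o ?s" for A
    using someI_ex[of "\<lambda>\<beta>. \<beta> \<in> Field ?r \<and> A \<subseteq> underS ?r \<beta>"] o2.small_set_bounded[OF that] unfolding ub_def by blast+
  \<comment> \<open>\<open>\<gamma> i\<close> lies strictly above all earlier
    \<open>\<gamma> j\<close> and also above all \<open>g (\<gamma> j)\<close>. Each stage below
    \<open>\<omega>\<^sub>1\<close> has only countably many predecessors, so a bound exists.\<close>
  define \<gamma> where "\<gamma> = wfrec (?s - Id) (\<lambda>f i. ub (f ` underS ?s i \<union> g ` f ` underS ?s i))"
  have \<gamma>: "\<gamma> i = ub (\<gamma> ` underS ?s i \<union> g ` \<gamma> ` underS ?s i)" for i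
  proof -
    have "cut \<gamma> (?s - Id) i ` underS ?s i = \<gamma> ` underS ?s i"
      by (intro image_cong) (auto simp: cut_def underS_def)
    then show ?thesis unfolding \<gamma>_def by (subst wfrec[OF s(3)]) (simp add: \<gamma>_def)
  qed
  have cnt: "countable (\<gamma> ` underS ?s i \<union> g ` \<gamma> ` underS ?s i)" if "i \<in> Field ?s" for i
    using o1.card_underS[OF that] unfolding countable_card_le_natLeq[symmetric] by auto
  have \<gamma>F: "\<gamma> i \<in> Field ?r" if "i \<in> Field ?s" for i
    using that
  proof (induction i rule: wf_induct_rule[OF s(3)])
    case (1 i)
    have "\<gamma> ` underS ?s i \<subseteq> Field ?r"
      using 1(1) underS_in_Field(1)[of _ ?s i] by (auto simp: underS_def)
    then show ?case
      unfolding \<gamma>[of i] using g(1) by (intro ub countable_imp_omega1 cnt 1(2)) auto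
  qed
  have \<gamma>ub: "\<gamma> ` underS ?s i \<union> g ` \<gamma> ` underS ?s i \<subseteq> underS ?r (\<gamma> i)" if "i \<in> Field ?s" for i
    unfolding \<gamma>[of i] using that \<gamma>F underS_in_Field(1)[of _ ?s i] g(1)
    by (intro ub countable_imp_omega1 cnt) auto
  define \<Gamma> where "\<Gamma> = \<gamma> ` Field ?s"
  have "|\<Gamma>| \<le>o ?s"
    unfolding \<Gamma>_def using card_of_image card_of_Field_ordIso[OF o1.r(1)] ordLeq_ordIso_trans by blast
  moreover have "\<Gamma> \<subseteq> Field ?r" unfolding \<Gamma>_def using \<gamma>F by blast
  ultimately obtain \<alpha>' where "\<alpha>' \<in> {\<alpha> \<in> Field ?r. \<Gamma> \<subseteq> underS ?r \<alpha>}"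
    using o2.small_set_bounded[of \<Gamma>] by blast
  then obtain \<alpha> where "\<alpha> \<in> {\<alpha> \<in> Field ?r. \<Gamma> \<subseteq> underS ?r \<alpha>}"
    and least: "\<And>\<beta>. (\<beta>, \<alpha>) \<in> ?r - Id \<Longrightarrow> \<beta> \<notin> {\<alpha> \<in> Field ?r. \<Gamma> \<subseteq> underS ?r \<alpha>}"
    by (rule wfE_min[OF r(3)]) (rule that)
  then have \<alpha>: "\<alpha> \<in> Field ?r" "\<Gamma> \<subseteq> underS ?r \<alpha>" by auto
  have "\<exists>i\<in>Field ?s. C \<alpha> \<subseteq> underS ?r (\<gamma> i)"
  proof (rule o1.chain_absorbs)
    show "relChain ?s (\<lambda>i. underS ?r (\<gamma> i))"
      unfolding relChain_def
    proof (intro allI impI)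
      fix i j assume ij: "(i, j) \<in> ?s"
      show "underS ?r (\<gamma> i) \<subseteq> underS ?r (\<gamma> j)"
      proof (cases "i = j")
        case False
        then have "\<gamma> i \<in> underS ?r (\<gamma> j)" using ij \<gamma>ub[of j] by (auto simp: underS_def Field_def)
        then show ?thesis using underS_trans[OF r(1,2)] by blast
      qed auto
    qed
    show "C \<alpha> \<subseteq> (\<Union>i\<in>Field ?s. underS ?r (\<gamma> i))"
    proof
      fix c assume "c \<in> C \<alpha>"
      then have c: "c \<in> underS ?r \<alpha>" using C(2)[OF \<alpha>(1)] by blast
      then have cF: "c \<in> Field ?r" by (rule underS_in_Field)
      \<comment> \<open>Leastness of \<alpha>: an element c below \<alpha> fails to bound the
        iteration, so c is at most some \<open>\<gamma> i\<close> and strictly below the next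
        ones.\<close>
      have "\<not> \<Gamma> \<subseteq> underS ?r c" using least[of c] c cF by (auto simp: underS_def)
      then obtain i where i: "i \<in> Field ?s" "\<gamma> i \<notin> underS ?r c" unfolding \<Gamma>_def by blast
      then have ci: "(c, \<gamma> i) \<in> ?r" using r(5)[OF \<gamma>F[OF i(1)] cF] by blast
      obtain j where j: "j \<in> Field ?s" "i \<in> underS ?s j" using o1.exists_above[OF i(1)] .
      then have "\<gamma> i \<in> underS ?r (\<gamma> j)" using \<gamma>ub by blast
      then have "c \<in> underS ?r (\<gamma> j)" by (rule rel_underS_trans[OF r(1,2) ci])
      then show "c \<in> (\<Union>i\<in>Field ?s. underS ?r (\<gamma> i))" using j(1) by blast
    qed
    show "|C \<alpha>| \<le>o natLeq" using C(1)[OF \<alpha>(1)] by (simp add: countable_card_le_natLeq)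
  qed
  then obtain i where i: "i \<in> Field ?s" "C \<alpha> \<subseteq> underS ?r (\<gamma> i)" by blast
  obtain j where j: "j \<in> Field ?s" "i \<in> underS ?s j" using o1.exists_above[OF i(1)] .
  have "g (\<gamma> i) \<in> underS ?r (\<gamma> j)" using \<gamma>ub j by blast
  moreover have "\<gamma> j \<in> underS ?r \<alpha>" using \<alpha>(2) j(1) unfolding \<Gamma>_def by blast
  ultimately have "g (\<gamma> i) \<in> underS ?r \<alpha>" by (rule underS_trans[OF r(1,2)])
  then show False using g(2)[OF \<gamma>F[OF i(1)] \<alpha>(1) i(2)] by blast
qed

text \<open>Pressing down yields a single \<gamma> that contains \<open>C \<alpha>\<close> for
  unboundedly many \<alpha>. There may be too many countable subsets of \<gamma> for a pigeonhole on
  the values of \<open>C\<close>. An embedding of \<gamma> into \<open>\<omega>\<^sub>1\<close>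
  writes it as an increasing union of countable sets \<open>As i\<close>; by regularity of
  \<open>\<omega>\<^sub>1\<close> each \<open>C \<alpha>\<close> lies in one of them, and only
  \<open>\<omega>\<^sub>1\<close> classes remain.\<close>

lemma countable_root:
  assumes C: "\<And>\<alpha>. \<alpha> \<in> Field \<omega>\<^sub>2 \<Longrightarrow> countable (C \<alpha>)" "\<And>\<alpha>. \<alpha> \<in> Field \<omega>\<^sub>2 \<Longrightarrow> C \<alpha> \<subseteq> underS \<omega>\<^sub>2 \<alpha>"
  obtains \<Delta> where "countable \<Delta>" "\<Delta> \<subseteq> Field \<omega>\<^sub>2" "unbounded_in \<omega>\<^sub>2 {\<alpha> \<in> Field \<omega>\<^sub>2. C \<alpha> \<subseteq> \<Delta>}"
proof -
  let ?r = "\<omega>\<^sub>2" and ?s = "\<omega>\<^sub>1"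
  obtain \<gamma> where \<gamma>: "\<gamma> \<in> Field ?r" "unbounded_in ?r {\<alpha> \<in> Field ?r. C \<alpha> \<subseteq> underS ?r \<gamma>}"
    using pressing_down[OF C] by blast
  have sF: "|Field ?s| =o ?s" by (rule card_of_Field_ordIso[OF o1.r(1)])
  have "|underS ?r \<gamma>| \<le>o |Field ?s|"
    using o2.card_underS[OF \<gamma>(1)] sF ordIso_symmetric ordLeq_ordIso_trans by blast
  then obtain e where e: "inj_on e (underS ?r \<gamma>)" "e ` underS ?r \<gamma> \<subseteq> Field ?s"
    unfolding card_of_ordLeq[symmetric] by blast
  define As where "As i = {x \<in> underS ?r \<gamma>. e x \<in> underS ?s i}" for i
  have ch: "relChain ?s As"
    using underS_relChain[OF o1.r(1)] unfolding relChain_def As_def by blast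
  have "\<exists>i. i \<in> Field ?s \<and> C \<alpha> \<subseteq> As i" if "\<alpha> \<in> {\<alpha> \<in> Field ?r. C \<alpha> \<subseteq> underS ?r \<gamma>}" for \<alpha>
  proof -
    have "C \<alpha> \<subseteq> (\<Union>i\<in>Field ?s. As i)"
    proof
      fix x assume "x \<in> C \<alpha>"
      then have x: "x \<in> underS ?r \<gamma>" using that by blast
      then obtain i where "i \<in> Field ?s" "e x \<in> underS ?s i" using e(2) o1.exists_above[of "e x"] by blast
      then show "x \<in> (\<Union>i\<in>Field ?s. As i)" using x by (auto simp: As_def)
    qed
    then show ?thesis using o1.chain_absorbs[OF ch, of "C \<alpha>"] C(1) that unfolding countable_card_le_natLeq by blast
  qed
  then have "\<forall>\<alpha>\<in>{\<alpha> \<in> Field ?r. C \<alpha> \<subseteq> underS ?r \<gamma>}. \<exists>i. i \<in> Field ?s \<and> C \<alpha> \<subseteq> As i" by blast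
  from bchoice[OF this] obtain i where i: "\<And>\<alpha>. \<alpha> \<in> {\<alpha> \<in> Field ?r. C \<alpha> \<subseteq> underS ?r \<gamma>} \<Longrightarrow> i \<alpha> \<in> Field ?s \<and> C \<alpha> \<subseteq> As (i \<alpha>)" by blast
  have "\<exists>k\<in>Field ?s. unbounded_in ?r {\<alpha> \<in> {\<alpha> \<in> Field ?r. C \<alpha> \<subseteq> underS ?r \<gamma>}. i \<alpha> = k}"
  proof (rule o2.pigeonhole[OF _ \<gamma>(2)])
    show "|Field ?s| \<le>o ?s" using sF ordIso_imp_ordLeq by blast
  qed (use i in auto)
  then obtain k where k: "k \<in> Field ?s" "unbounded_in ?r {\<alpha> \<in> {\<alpha> \<in> Field ?r. C \<alpha> \<subseteq> underS ?r \<gamma>}. i \<alpha> = k}"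
    by blast
  show ?thesis
  proof (rule that[of "As k"])
    have "inj_on e (As k)" using e(1) by (rule inj_on_subset) (auto simp: As_def)
    moreover have "countable (underS ?s k)"
      using o1.card_underS[OF k(1)] by (simp add: countable_card_le_natLeq)
    ultimately show "countable (As k)"
      by (rule_tac countable_image_inj_on[of e "As k"]) (auto intro: countable_subset[of _ "underS ?s k"] simp: As_def)
    show "As k \<subseteq> Field ?r" using underS_in_Field(1)[of _ ?r \<gamma>] by (auto simp: As_def)
    have "{\<alpha> \<in> {\<alpha> \<in> Field ?r. C \<alpha> \<subseteq> underS ?r \<gamma>}. i \<alpha> = k} \<subseteq> {\<alpha> \<in> Field ?r. C \<alpha> \<subseteq> As k}" using i by blast
    then show "unbounded_in ?r {\<alpha> \<in> Field ?r. C \<alpha> \<subseteq> As k}"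
      using k(2) unfolding unbounded_in_def by blast
  qed
qed

subsection \<open>\<open>\<omega>\<^sub>2\<close> is a precaliber of measures\<close>

lemma sigma_sets_countably_generated:
  assumes "T \<in> sigma_sets \<Omega> (H ` A)"
  shows "\<exists>C\<subseteq>A. countable C \<and> T \<in> sigma_sets \<Omega> (H ` C)"
  using assms
proof induction
  case (Basic T)
  then obtain i where "i \<in> A" "T = H i" by blast
  then show ?case by (intro exI[of _ "{i}"]) (auto intro: sigma_sets.Basic)
next
  case Empty
  show ?case by (intro exI[of _ "{}"]) (auto intro: sigma_sets.Empty)
next
  case (Compl T)
  then obtain C where "C \<subseteq> A" "countable C" "T \<in> sigma_sets \<Omega> (H ` C)" by blast
  then show ?case by (intro exI[of _ C]) (auto intro: sigma_sets.Compl)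
next
  case (Union T)
  then have "\<forall>i. \<exists>C. C \<subseteq> A \<and> countable C \<and> T i \<in> sigma_sets \<Omega> (H ` C)" by blast
  from choice[OF this] obtain C where C: "\<forall>i. C i \<subseteq> A \<and> countable (C i) \<and> T i \<in> sigma_sets \<Omega> (H ` C i)" ..
  have "T i \<in> sigma_sets \<Omega> (H ` (\<Union>i. C i))" for i
  proof -
    have "sigma_sets \<Omega> (H ` C i) \<subseteq> sigma_sets \<Omega> (H ` (\<Union>i. C i))" by (rule sigma_sets_mono') auto
    then show ?thesis using C by blast
  qed
  then show ?case using C by (intro exI[of _ "\<Union>i. C i"]) (auto intro: sigma_sets.Union)
qed

text \<open>Among the sets of the generated algebra that cover \<open>H\<close> up to a null set,
  the intersection of a minimising sequence has least measure. If B meets \<open>H\<close> in a null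
  set, removing B from it leaves a cover, so minimality forces B to meet it in a null set as
  well.\<close>

lemma (in finite_measure) measurable_envelope:
  assumes \<G>: "\<G> \<subseteq> sets M" and H: "H \<in> sets M"
  obtains T where "T \<in> sigma_sets (space M) \<G>" "emeasure M (H - T) = 0"
    "\<And>B. B \<in> sigma_sets (space M) \<G> \<Longrightarrow> emeasure M (B \<inter> H) = 0 \<Longrightarrow> emeasure M (B \<inter> T) = 0"
proof -
  have Gp: "\<G> \<subseteq> Pow (space M)" using \<G> sets.sets_into_space by blast
  interpret G: sigma_algebra "space M" "sigma_sets (space M) \<G>"
    by (rule sigma_algebra_sigma_sets[OF Gp])
  have GM: "T \<in> sets M" if "T \<in> sigma_sets (space M) \<G>" for T
    using that sets.sigma_sets_subset[OF \<G>] by blast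
  define \<T> where "\<T> = {T \<in> sigma_sets (space M) \<G>. emeasure M (H - T) = 0}"
  have "H - space M = {}" using sets.sets_into_space[OF H] by auto
  then have "space M \<in> \<T>"
    unfolding \<T>_def mem_Collect_eq by (simp only: emeasure_empty sigma_sets_top simp_thms)
  then have "emeasure M ` \<T> \<noteq> {}" by blast
  from ennreal_Inf_countable_INF[OF this] obtain f :: "nat \<Rightarrow> ennreal" where
    f: "range f \<subseteq> emeasure M ` \<T>" "Inf (emeasure M ` \<T>) = (INF n. f n)" by blast
  have "\<forall>n. \<exists>T. T \<in> \<T> \<and> f n = emeasure M T" using f(1) by blast
  from choice[OF this] obtain T where T: "\<And>n. T n \<in> \<T>" "\<And>n. f n = emeasure M (T n)" by blast
  have T\<G>: "T n \<in> sigma_sets (space M) \<G>" and Tnull: "H - T n \<in> null_sets M" for n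
    using T(1)[of n] H GM by (auto simp: \<T>_def null_sets_def)
  define E where "E = (\<Inter>n. T n)"
  have E: "E \<in> sigma_sets (space M) \<G>" unfolding E_def using T\<G> by (intro G.countable_INT) auto
  have HE: "H - E \<in> null_sets M"
  proof -
    have eq: "H - E = (\<Union>n. H - T n)" by (auto simp: E_def)
    show ?thesis unfolding eq by (intro null_sets_UN Tnull)
  qed
  have min: "emeasure M E \<le> emeasure M T'" if "T' \<in> \<T>" for T'
  proof -
    have "emeasure M E \<le> (INF n. f n)"
      unfolding T(2) E_def using T\<G> GM by (intro INF_greatest emeasure_mono) auto
    also have "\<dots> \<le> emeasure M T'" unfolding f(2)[symmetric] using that by (intro Inf_lower) auto
    finally show ?thesis .
  qed
  show ?thesis
  proof (rule that[OF E])
    show "emeasure M (H - E) = 0" using HE by auto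
    fix B assume B: "B \<in> sigma_sets (space M) \<G>" "emeasure M (B \<inter> H) = 0"
    have BH: "B \<inter> H \<in> null_sets M" using B GM H by auto
    have "H - (E - B) \<in> null_sets M"
      using E B(1) GM H by (intro null_sets_subset[OF null_sets.Un[OF HE BH]]) auto
    then have "E - B \<in> \<T>" using E B(1) by (auto simp: \<T>_def)
    then have "measure M E \<le> measure M (E - B)" using min by (simp add: emeasure_eq_measure)
    also have "\<dots> = measure M E - measure M (E \<inter> B)"
      using E B(1) GM finite_measure_Diff'[of E B] by auto
    finally have "measure M (E \<inter> B) = 0" using measure_nonneg[of M "E \<inter> B"] by linarith
    then show "emeasure M (B \<inter> E) = 0" by (simp add: emeasure_eq_measure Int_commute)
  qed
qed

lemma card_sample_points:
  assumes "|B| \<le>o \<omega>\<^sub>1"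
  shows "|sample_points B| \<le>o \<omega>\<^sub>1"
proof -
  have "|(UNIV :: nat set) \<times> B| \<le>o \<omega>\<^sub>1"
    by (rule card_of_Times_ordLeq_infinite_Field[OF o2.\<kappa>(2) countable_imp_omega1 assms o2.\<kappa>(1)]) simp
  with card_of_image show ?thesis unfolding sample_points_def by (rule ordLeq_transitive)
qed

text \<open>The largest index is peeled off first: everything else is measurable in the algebra for
  which \<open>T\<close> is an envelope of \<open>H\<close>.\<close>

lemma finite_positive_intersections:
  fixes H T :: "'i \<Rightarrow> 'a set"
  assumes M: "prob_space M" and r: "Card_order r" and H: "\<And>i. i \<in> Field r \<Longrightarrow> H i \<in> sets M"
    and \<Delta>: "\<Delta> \<subseteq> Field r" and S: "S \<subseteq> Field r" "\<And>i. i \<in> S \<Longrightarrow> \<Delta> \<subseteq> underS r i"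
    and T: "\<And>i. i \<in> S \<Longrightarrow> T i \<in> sigma_sets (space M) (H ` \<Delta>)"
      "\<And>i B. i \<in> S \<Longrightarrow> B \<in> sigma_sets (space M) (H ` underS r i) \<Longrightarrow> emeasure M (B \<inter> H i) = 0 \<Longrightarrow> emeasure M (B \<inter> T i) = 0"
    and F: "finite F" "F \<subseteq> S" and B: "B \<in> sigma_sets (space M) (H ` \<Delta>)"
    and pos: "emeasure M (B \<inter> (\<Inter>i\<in>F. T i)) > 0"
  shows "emeasure M (B \<inter> (\<Inter>i\<in>F. H i)) > 0"
  using F B pos
proof (induction "card F" arbitrary: F B)
  case 0
  then show ?case by simp
next
  case (Suc n)
  have sa: "sigma_algebra (space M) (sigma_sets (space M) (H ` A))" if "A \<subseteq> Field r" for A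
    using H that sets.sets_into_space by (intro sigma_algebra_sigma_sets) blast
  interpret D: sigma_algebra "space M" "sigma_sets (space M) (H ` \<Delta>)" by (rule sa) fact
  have "F \<noteq> {}" using Suc.hyps(2) by auto
  then obtain m where m: "m \<in> F" "\<forall>j\<in>F. (j, m) \<in> r"
    using finite_has_greatest_wo[OF Suc.prems(1) _ _ Card_order_rels(4)[OF r]] Suc.prems(2) S(1) by blast
  define G where "G = F - {m}"
  have G: "finite G" "G \<subseteq> S" "n = card G" "F = insert m G" "G \<subseteq> underS r m"
    using Suc.prems Suc.hyps(2) m by (auto simp: G_def underS_def)
  have mS: "m \<in> S" using m(1) Suc.prems(2) by blast
  interpret U: sigma_algebra "space M" "sigma_sets (space M) (H ` underS r m)"
    by (rule sa) (auto dest: underS_in_Field)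
  \<comment> \<open>The envelope \<open>T m\<close> is absorbed into the set \<open>B\<close>, which
    is possible because it is generated by the \<open>H i\<close> with i in \<Delta>. The induction
    hypothesis then replaces all other envelopes by the sets themselves.\<close>
  have "emeasure M ((B \<inter> T m) \<inter> (\<Inter>i\<in>G. T i)) > 0"
    using Suc.prems(4) unfolding G(4) by (simp add: Int_assoc)
  then have "emeasure M ((B \<inter> T m) \<inter> (\<Inter>i\<in>G. H i)) > 0"
    by (intro Suc.hyps(1) G D.Int Suc.prems T mS)
  moreover have "(B \<inter> T m) \<inter> (\<Inter>i\<in>G. H i) = (B \<inter> (\<Inter>i\<in>G. H i)) \<inter> T m" by auto
  moreover have "B \<inter> (\<Inter>i\<in>G. H i) \<in> sigma_sets (space M) (H ` underS r m)"
  proof -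
    have BU: "B \<in> sigma_sets (space M) (H ` underS r m)"
      using Suc.prems(3) sigma_sets_mono'[of "H ` \<Delta>" "H ` underS r m" "space M"] S(2)[OF mS] by blast
    show ?thesis
      using G(1,5)
    proof (induction G rule: finite_induct)
      case empty
      then show ?case using BU by simp
    next
      case (insert i G)
      then have "B \<inter> (\<Inter>i\<in>G. H i) \<in> sigma_sets (space M) (H ` underS r m)" by blast
      moreover have "H i \<in> sigma_sets (space M) (H ` underS r m)"
        using insert by (intro sigma_sets.Basic) auto
      ultimately have "(B \<inter> (\<Inter>i\<in>G. H i)) \<inter> H i \<in> sigma_sets (space M) (H ` underS r m)"
        by (rule U.Int)
      then show ?case by (simp add: Int_ac)
    qed
  qed
  \<comment> \<open>Only predecessors of m are involved outside \<open>T m\<close>, so the envelope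
    property applies: a null intersection with \<open>H m\<close> would be a null intersection with
    \<open>T m\<close>.\<close>
  ultimately have "emeasure M ((B \<inter> (\<Inter>i\<in>G. H i)) \<inter> H m) > 0"
    using T(2)[OF mS] by (metis not_gr_zero)
  then show ?case unfolding G(4) by (simp add: Int_ac)
qed

text \<open>All surviving envelopes lie in one countably generated algebra. There,
  \<open>centered_classes\<close> makes finite intersections of envelopes in one class positive, and
  \<open>finite_positive_intersections\<close> passes from the envelopes back to the sets
  \<open>H i\<close>.\<close>

lemma omega2_precaliber:
  fixes H :: "nat set set \<Rightarrow> 'a set" and X :: "(nat \<Rightarrow> bool) set"
  assumes X: "\<And>N. N \<in> null_sets (coins UNIV) \<Longrightarrow> \<not> X \<subseteq> N" "|X| \<le>o \<omega>\<^sub>1"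
    and M: "prob_space M" and H: "\<And>i. i \<in> Field \<omega>\<^sub>2 \<Longrightarrow> H i \<in> sets M" "\<And>i. i \<in> Field \<omega>\<^sub>2 \<Longrightarrow> emeasure M (H i) > 0"
  obtains S where "S \<subseteq> Field \<omega>\<^sub>2" "unbounded_in \<omega>\<^sub>2 S"
    "\<And>F. finite F \<Longrightarrow> F \<subseteq> S \<Longrightarrow> emeasure M {x \<in> space M. \<forall>i\<in>F. x \<in> H i} > 0"
proof -
  let ?r = "\<omega>\<^sub>2"
  interpret M: prob_space M by fact
  define env where "env i T \<longleftrightarrow> T \<in> sigma_sets (space M) (H ` underS ?r i) \<and> emeasure M (H i - T) = 0 \<and>
    (\<forall>B \<in> sigma_sets (space M) (H ` underS ?r i). emeasure M (B \<inter> H i) = 0 \<longrightarrow> emeasure M (B \<inter> T) = 0)" for i T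
  have "\<forall>i\<in>Field ?r. \<exists>T. env i T"
  proof
    fix i assume i: "i \<in> Field ?r"
    have "H ` underS ?r i \<subseteq> sets M" using H(1) underS_in_Field(1)[of _ ?r i] by blast
    from M.measurable_envelope[OF this H(1)[OF i]] show "\<exists>T. env i T" unfolding env_def by metis
  qed
  from bchoice[OF this] obtain T where T: "\<forall>i\<in>Field ?r. env i (T i)" ..
  have "\<forall>i\<in>Field ?r. \<exists>C. C \<subseteq> underS ?r i \<and> countable C \<and> T i \<in> sigma_sets (space M) (H ` C)"
    using T sigma_sets_countably_generated unfolding env_def by blast
  from bchoice[OF this] obtain C where
    C: "\<forall>i\<in>Field ?r. C i \<subseteq> underS ?r i \<and> countable (C i) \<and> T i \<in> sigma_sets (space M) (H ` C i)" ..
  obtain \<Delta> where \<Delta>: "countable \<Delta>" "\<Delta> \<subseteq> Field ?r" "unbounded_in ?r {\<alpha> \<in> Field ?r. C \<alpha> \<subseteq> \<Delta>}"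
    by (rule countable_root[of C]) (use C in auto)
  obtain \<delta> where \<delta>: "\<delta> \<in> Field ?r" "\<Delta> \<subseteq> underS ?r \<delta>"
    using o2.small_set_bounded[OF \<Delta>(2) countable_imp_omega1[OF \<Delta>(1)]] by blast
  note rr = Card_order_rels[OF o2.r(1)]
  \<comment> \<open>Indices are kept only beyond the bound \<delta> of \<Delta>, so that every set
    generated over \<Delta> belongs to the algebra of predecessors of each index kept.\<close>
  define S1 where "S1 = {\<alpha> \<in> Field ?r. C \<alpha> \<subseteq> \<Delta> \<and> \<delta> \<in> underS ?r \<alpha>}"
  have "unbounded_in ?r S1"
    unfolding unbounded_in_def
  proof
    fix \<beta> assume \<beta>: "\<beta> \<in> Field ?r"
    have "|{\<beta>, \<delta>}| \<le>o \<omega>\<^sub>1" by (rule countable_imp_omega1) simp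
    then obtain \<epsilon> where \<epsilon>: "\<epsilon> \<in> Field ?r" "{\<beta>, \<delta>} \<subseteq> underS ?r \<epsilon>"
      using o2.small_set_bounded[of "{\<beta>, \<delta>}"] \<beta> \<delta>(1) by blast
    obtain \<alpha> where \<alpha>: "\<alpha> \<in> Field ?r" "C \<alpha> \<subseteq> \<Delta>" "\<epsilon> \<in> underS ?r \<alpha>"
      using \<Delta>(3) \<epsilon>(1) unfolding unbounded_in_def by blast
    have "\<beta> \<in> underS ?r \<alpha>" "\<delta> \<in> underS ?r \<alpha>" using \<epsilon>(2) \<alpha>(3) underS_trans[OF rr(1,2)] by blast+
    then show "\<exists>\<alpha>\<in>S1. \<beta> \<in> underS ?r \<alpha>" using \<alpha> unfolding S1_def by blast
  qed
  have S1: "S1 \<subseteq> Field ?r" by (auto simp: S1_def)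
  have TD: "T i \<in> sigma_sets (space M) (H ` \<Delta>)" if "i \<in> S1" for i
    using that C sigma_sets_mono'[of "H ` C i" "H ` \<Delta>" "space M"] by (auto simp: S1_def)
  have HD: "H ` \<Delta> \<subseteq> sets M" using H(1) \<Delta>(2) by blast
  have DM: "A \<in> sets M" if "A \<in> sigma_sets (space M) (H ` \<Delta>)" for A
    using that sets.sigma_sets_subset[OF HD] by blast
  have Tpos: "emeasure M (T i) > 0" if i: "i \<in> S1" for i
  proof -
    have iF: "i \<in> Field ?r" using i S1 by blast
    have "emeasure M (H i) \<le> emeasure M (T i \<union> (H i - T i))"
      using DM[OF TD[OF i]] H(1)[OF iF] by (intro emeasure_mono) auto
    also have "\<dots> \<le> emeasure M (T i) + emeasure M (H i - T i)"
      using DM[OF TD[OF i]] H(1)[OF iF] by (intro emeasure_subadditive) auto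
    also have "emeasure M (H i - T i) = 0" using T iF unfolding env_def by blast
    finally show ?thesis using H(2)[OF iF] by (simp add: less_le_trans)
  qed
  have cD: "countable (H ` \<Delta>)" using \<Delta>(1) by simp
  obtain z where z: "\<And>T. T \<in> sigma_sets (space M) (H ` \<Delta>) \<Longrightarrow> emeasure M T > 0 \<Longrightarrow> z T \<in> sample_points X"
    "\<And>F c. finite F \<Longrightarrow> F \<subseteq> sigma_sets (space M) (H ` \<Delta>) \<Longrightarrow> \<forall>T\<in>F. emeasure M T > 0 \<and> z T = c \<Longrightarrow>
      emeasure M {x \<in> space M. \<forall>T\<in>F. x \<in> T} > 0"
    by (rule centered_classes[OF X(1) M cD HD], assumption, rule that)
  have "\<exists>c\<in>sample_points X. unbounded_in ?r {\<alpha> \<in> S1. z (T \<alpha>) = c}"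
    by (rule o2.pigeonhole[OF S1 \<open>unbounded_in ?r S1\<close> _ card_sample_points[OF X(2)]])
      (use z(1) TD Tpos in blast)
  then obtain c where c: "unbounded_in ?r {\<alpha> \<in> S1. z (T \<alpha>) = c}" by blast
  show ?thesis
  proof (rule that[OF _ c])
    show "{\<alpha> \<in> S1. z (T \<alpha>) = c} \<subseteq> Field ?r" using S1 by blast
    fix F assume F: "finite F" "F \<subseteq> {\<alpha> \<in> S1. z (T \<alpha>) = c}"
    have "emeasure M {x \<in> space M. \<forall>A\<in>T ` F. x \<in> A} > 0"
      using F TD Tpos by (intro z(2)[of _ c]) auto
    then have "emeasure M (space M \<inter> (\<Inter>i\<in>F. T i)) > 0" by (simp add: Int_def)
    then have "emeasure M (space M \<inter> (\<Inter>i\<in>F. H i)) > 0"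
    proof (rule finite_positive_intersections[OF M o2.r(1) H(1) \<Delta>(2) S1, rotated -1])
      show "\<Delta> \<subseteq> underS ?r i" if "i \<in> S1" for i
        using that \<delta>(2) underS_trans[OF rr(1,2)] unfolding S1_def by blast
      show "emeasure M (B \<inter> T i) = 0"
        if "i \<in> S1" "B \<in> sigma_sets (space M) (H ` underS ?r i)" "emeasure M (B \<inter> H i) = 0" for i B
        using T that S1 unfolding env_def by blast
      show "space M \<in> sigma_sets (space M) (H ` \<Delta>)" by (rule sigma_sets_top)
    qed (use F TD in auto)
    then show "emeasure M {x \<in> space M. \<forall>i\<in>F. x \<in> H i} > 0" by (simp add: Int_def)
  qed
qed

subsection \<open>Separability\<close>

lemma cantor_measure_eq_coins: "cantor_measure \<kappa> = coins (Field \<kappa>)"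
  by (simp add: cantor_measure_def)

lemma non_null_witness:
  assumes "non_null natLeq =o \<omega>\<^sub>1"
  obtains X :: "(nat \<Rightarrow> bool) set" where "|X| \<le>o \<omega>\<^sub>1" "\<And>N. N \<in> null_sets (coins UNIV) \<Longrightarrow> \<not> X \<subseteq> N"
proof -
  interpret prob_space "coins (UNIV :: nat set)" by (rule prob_space_coins)
  have eq: "cantor_measure natLeq = coins UNIV" by (simp add: cantor_measure_eq_coins Field_natLeq)
  let ?F = "{X. X \<subseteq> space (cantor_measure natLeq) \<and> X \<notin> null_ideal natLeq}"
  have "space (coins UNIV) \<notin> null_sets (completion (coins (UNIV :: nat set)))"
    unfolding null_sets_completion_iff[OF sets.top] using emeasure_space_1 by (auto simp: null_sets_def)
  then have "?F \<noteq> {}" unfolding null_ideal_def eq by blast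
  from min_card_attained_least[OF this] obtain X where X: "X \<in> ?F" "min_card ?F = |X|" by blast
  show ?thesis
  proof (rule that)
    show "|X| \<le>o \<omega>\<^sub>1"
      using assms X(2) unfolding non_ideal_def by (metis ordIso_imp_ordLeq)
    show "\<not> X \<subseteq> N" if "N \<in> null_sets (coins UNIV)" for N
      using X(1) that unfolding null_ideal_def eq mem_Collect_eq null_sets_completion_iff2 by blast
  qed
qed

lemma few_null_sets_do_not_cover:
  assumes c: "cov_null \<omega>\<^sub>2 =o \<omega>\<^sub>2" and \<N>: "\<N> \<subseteq> null_sets (coins (Field \<omega>\<^sub>2))" "|\<N>| \<le>o \<omega>\<^sub>1"
  shows "\<exists>b\<in>space (coins (Field \<omega>\<^sub>2)). b \<notin> \<Union>\<N>"
proof (rule ccontr)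
  assume "\<not> ?thesis"
  moreover have "\<Union>\<N> \<subseteq> space (coins (Field \<omega>\<^sub>2))" using \<N>(1) sets.sets_into_space by blast
  ultimately have "\<Union>\<N> = space (cantor_measure \<omega>\<^sub>2)" unfolding cantor_measure_eq_coins by blast
  moreover have "\<N> \<subseteq> null_ideal \<omega>\<^sub>2"
    unfolding null_ideal_def cantor_measure_eq_coins using \<N>(1) null_sets_completionI by blast
  ultimately have m: "\<N> \<in> {A. A \<subseteq> null_ideal \<omega>\<^sub>2 \<and> \<Union>A = space (cantor_measure \<omega>\<^sub>2)}" by blast
  then have "{A. A \<subseteq> null_ideal \<omega>\<^sub>2 \<and> \<Union>A = space (cantor_measure \<omega>\<^sub>2)} \<noteq> {}" by blast
  from min_card_attained_least[OF this] m have le: "cov_null \<omega>\<^sub>2 \<le>o |\<N>|"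
    unfolding cov_ideal_def by blast
  have "\<omega>\<^sub>2 =o cov_null \<omega>\<^sub>2" using c by (rule ordIso_symmetric)
  also note le
  also note \<N>(2)
  finally have "\<omega>\<^sub>2 \<le>o \<omega>\<^sub>1" .
  then show False using cardSuc_greater[OF o2.\<kappa>(1)] not_ordLess_ordLeq by blast
qed

lemma pi_base_of_small_cardinality:
  assumes "pi_character K \<le>o \<omega>\<^sub>1" "x \<in> topspace K"
  obtains P where "pi_base_at K x P" "|P| \<le>o \<omega>\<^sub>1" "P \<noteq> {}"
proof -
  have le: "pi_char_at K x \<le>o \<omega>\<^sub>1"
    using assms pi_character_le_iff[OF o2.\<kappa>(1), of K] by blast
  have "pi_base_at K x {U. openin K U \<and> U \<noteq> {}}" by (auto simp: pi_base_at_def)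
  then have "{P. pi_base_at K x P} \<noteq> {}" by blast
  from min_card_attained_least[OF this] obtain P where P: "pi_base_at K x P" "pi_char_at K x = |P|"
    unfolding pi_char_at_def by blast
  moreover have "P \<noteq> {}" using P(1) assms(2) unfolding pi_base_at_def by blast
  ultimately show ?thesis using that le by simp
qed

theorem theorem5p5:
  fixes K :: "'a topology"
  assumes "\<cc> =o \<omega>\<^sub>2"
    and "non_null natLeq =o \<omega>\<^sub>1"
    and "cov_null \<omega>\<^sub>2 =o \<cc>"
    and "compact_space K" and "Hausdorff_space K"
    and "supports_measure K"
    and "pi_character K \<le>o \<omega>\<^sub>1"
  shows "separable_space K"
proof (rule ccontr)
  assume nsep: "\<not> separable_space K"
  have ne: "topspace K \<noteq> {}"
  proof
    assume "topspace K = {}"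
    then have "separable_space K" unfolding separable_space_def by (intro exI[of _ "{}"]) simp
    with nsep show False by contradiction
  qed
  obtain \<mu> where \<mu>: "radon_measure_on K \<mu>" and pos: "\<And>U. openin K U \<Longrightarrow> U \<noteq> {} \<Longrightarrow> emeasure \<mu> U > 0"
    using assms(6) unfolding supports_measure_def by auto
  note \<mu>D = radon_measure_onD[OF \<mu>]
  have "cov_null \<omega>\<^sub>2 =o \<omega>\<^sub>2" using assms(3,1) by (rule ordIso_transitive)
  note cov = few_null_sets_do_not_cover[OF this]
  have F1: "|Field \<omega>\<^sub>1| =o \<omega>\<^sub>1" by (rule card_of_Field_ordIso[OF o2.\<kappa>(1)])
  have F2: "|Field \<omega>\<^sub>2| =o \<omega>\<^sub>2" by (rule card_of_Field_ordIso[OF o2.r(1)])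
  have le2: "\<omega>\<^sub>1 \<le>o |Field \<omega>\<^sub>2|"
    using cardSuc_ordLeq[OF o2.\<kappa>(1)] ordIso_symmetric[OF F2] by (rule ordLeq_ordIso_trans)
  \<comment> \<open>The pi-bases are indexed by subsets of \<open>nat\<close>, the labels of the
    trees. This works because \<open>\<omega>\<^sub>1\<close> is realised on a set of subsets of
    \<open>nat\<close>.\<close>
  have "\<forall>x\<in>topspace K. \<exists>p :: nat set \<Rightarrow> 'a set. pi_base_at K x (range p) \<and> |range p| \<le>o \<omega>\<^sub>1"
  proof
    fix x assume "x \<in> topspace K"
    then obtain P where P: "pi_base_at K x P" "|P| \<le>o \<omega>\<^sub>1" "P \<noteq> {}"
      by (rule pi_base_of_small_cardinality[OF assms(7)])
    have "|P| \<le>o |Field \<omega>\<^sub>1|" using P(2) ordIso_symmetric[OF F1] by (rule ordLeq_ordIso_trans)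
    also have "|Field \<omega>\<^sub>1| \<le>o |UNIV :: nat set set|" by (rule card_of_mono1) simp
    finally obtain p :: "nat set \<Rightarrow> 'a set" where "range p = P"
      using card_of_ordLeq2[OF P(3), of "UNIV :: nat set set"] by blast
    then show "\<exists>p :: nat set \<Rightarrow> 'a set. pi_base_at K x (range p) \<and> |range p| \<le>o \<omega>\<^sub>1" using P by blast
  qed
  from bchoice[OF this] obtain p :: "'a \<Rightarrow> nat set \<Rightarrow> 'a set" where
    p: "\<And>x. x \<in> topspace K \<Longrightarrow> pi_base_at K x (range (p x))" "\<And>x. x \<in> topspace K \<Longrightarrow> |range (p x)| \<le>o \<omega>\<^sub>1"
    by blast
  have pop: "openin K U" "U \<noteq> {}" if "x \<in> topspace K" "U \<in> range (p x)" for x U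
    using p(1)[OF that(1)] that(2) unfolding pi_base_at_def by blast+
  have psub: "\<exists>U\<in>range (p x). U \<subseteq> V" if "openin K V" "x \<in> V" for x V
    using p(1)[of x] that openin_subset[OF that(1)] unfolding pi_base_at_def by blast

  have not_dense: "K closure_of Y \<noteq> topspace K" if Y: "Y \<subseteq> topspace K" "|Y| \<le>o \<omega>\<^sub>1" for Y
  proof
    assume dense: "K closure_of Y = topspace K"
    \<comment> \<open>The pi-bases at the points of \<open>Y\<close> are together only
      \<open>\<omega>\<^sub>1\<close> many open sets. A countable set meeting all of them is dense:
      every nonempty open set contains a point of the dense set \<open>Y\<close> and hence a member
      of the pi-base there.\<close>
    define \<U> where "\<U> = (\<Union>y\<in>Y. range (p y))"
    have "|\<U>| \<le>o \<omega>\<^sub>1"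
      unfolding \<U>_def using Y p(2)
      by (intro card_of_UNION_ordLeq_infinite_Field[OF o2.\<kappa>(2,1)]) auto
    moreover have \<U>op: "openin K U" "U \<noteq> {}" if "U \<in> \<U>" for U
      using that pop Y(1) unfolding \<U>_def by blast+
    ultimately obtain Q where Q: "countable Q" "Q \<subseteq> topspace K" "\<And>U. U \<in> \<U> \<Longrightarrow> U \<inter> Q \<noteq> {}"
      using open_sets_hit_by_countable[where \<U>=\<U>, OF assms(4,5) \<mu> pos \<U>op o2.\<kappa> _ le2 cov] by metis
    have "K closure_of Q = topspace K"
    proof (rule ccontr)
      assume "K closure_of Q \<noteq> topspace K"
      then obtain x where x: "x \<in> topspace K" "x \<notin> K closure_of Q"
        using closure_of_subset_topspace[of K Q] by blast
      then obtain V where V: "openin K V" "x \<in> V" "V \<inter> Q = {}" unfolding in_closure_of by blast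
      obtain y where y: "y \<in> Y" "y \<in> V" using x(1) V(1,2) dense in_closure_of[of x K Y] by blast
      obtain U where "U \<in> range (p y)" "U \<subseteq> V" using psub[OF V(1) y(2)] by blast
      then show False using Q(3)[of U] V(3) y(1) unfolding \<U>_def by blast
    qed
    with Q(1,2) nsep show False unfolding separable_space_def by blast
  qed

  have "|UNIV :: (nat \<Rightarrow> bool) set| =o \<cc>"
    by (simp add: cexp_def ctwo_def Field_natLeq Field_card_of Func_def card_of_refl)
  then have "|UNIV :: op_tree set| \<le>o |Field \<omega>\<^sub>2|"
    using card_op_tree assms(1) ordIso_symmetric[OF F2] by (meson ordLeq_ordIso_trans)
  \<comment> \<open>Here the size of the continuum enters. The named points are listed, possibly
    with repetitions, along \<open>\<omega>\<^sub>2\<close>, so that every proper initial segment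
    has size at most \<open>\<omega>\<^sub>1\<close> and is not dense.\<close>
  then obtain t where t: "t ` Field \<omega>\<^sub>2 = (UNIV :: op_tree set)"
    using card_of_ordLeq2[of "UNIV :: op_tree set" "Field \<omega>\<^sub>2"] by blast
  define d where "d \<alpha> = op_point K p (t \<alpha>)" for \<alpha>
  have dK: "d \<alpha> \<in> topspace K" for \<alpha> unfolding d_def by (rule op_point_in[OF ne])
  have "d ` Field \<omega>\<^sub>2 = range (op_point K p)" unfolding d_def using t by (metis image_image)
  then have dense: "K closure_of (d ` Field \<omega>\<^sub>2) = topspace K"
    using dense_range_op_point[OF assms(4,5) ne \<mu> pos p(1)] by simp
  define E where "E \<alpha> = K closure_of (d ` underS \<omega>\<^sub>2 \<alpha>)" for \<alpha>
  have "\<forall>\<alpha>\<in>Field \<omega>\<^sub>2. \<exists>H. closedin K H \<and> H \<subseteq> topspace K - E \<alpha> \<and> emeasure \<mu> H > 0"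
  proof
    fix \<alpha> assume \<alpha>: "\<alpha> \<in> Field \<omega>\<^sub>2"
    have "|d ` underS \<omega>\<^sub>2 \<alpha>| \<le>o \<omega>\<^sub>1" using card_of_image o2.card_underS[OF \<alpha>] by (rule ordLeq_transitive)
    then have "E \<alpha> \<noteq> topspace K" unfolding E_def using dK by (intro not_dense) auto
    then have "topspace K - E \<alpha> \<noteq> {}" using closure_of_subset_topspace[of K "d ` underS \<omega>\<^sub>2 \<alpha>"] unfolding E_def by blast
    moreover have "openin K (topspace K - E \<alpha>)" unfolding E_def by (intro openin_diff) auto
    ultimately show "\<exists>H. closedin K H \<and> H \<subseteq> topspace K - E \<alpha> \<and> emeasure \<mu> H > 0"
      by (intro positive_closed_subset[OF assms(5) \<mu> pos])
  qed
  from bchoice[OF this] obtain H where H: "\<And>\<alpha>. \<alpha> \<in> Field \<omega>\<^sub>2 \<Longrightarrow> closedin K (H \<alpha>)"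
    "\<And>\<alpha>. \<alpha> \<in> Field \<omega>\<^sub>2 \<Longrightarrow> H \<alpha> \<subseteq> topspace K - E \<alpha>" "\<And>\<alpha>. \<alpha> \<in> Field \<omega>\<^sub>2 \<Longrightarrow> emeasure \<mu> (H \<alpha>) > 0"
    by blast
  define M where "M = uniform_measure \<mu> (space \<mu>)"
  have M: "prob_space M" unfolding M_def
    using pos[of "topspace K"] ne finite_measure.emeasure_finite[OF \<mu>D(2)]
    by (intro prob_space_uniform_measure) (auto simp: \<mu>D(1))
  have HM: "H \<alpha> \<in> sets M" "emeasure M (H \<alpha>) > 0" if "\<alpha> \<in> Field \<omega>\<^sub>2" for \<alpha>
  proof -
    have m: "H \<alpha> \<in> sets \<mu>" using H(1)[OF that] by (rule \<mu>D)
    then show "H \<alpha> \<in> sets M" by (simp add: M_def)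
    show "emeasure M (H \<alpha>) > 0"
      unfolding M_def emeasure_uniform_space_pos_iff[OF \<mu>D(2) m] by (rule H(3)[OF that])
  qed
  obtain X :: "(nat \<Rightarrow> bool) set" where X: "|X| \<le>o \<omega>\<^sub>1" "\<And>N. N \<in> null_sets (coins UNIV) \<Longrightarrow> \<not> X \<subseteq> N"
    by (rule non_null_witness[OF assms(2)]) (rule that)
  obtain S where S: "S \<subseteq> Field \<omega>\<^sub>2" "unbounded_in \<omega>\<^sub>2 S"
    "\<And>F. finite F \<Longrightarrow> F \<subseteq> S \<Longrightarrow> emeasure M {x \<in> space M. \<forall>i\<in>F. x \<in> H i} > 0"
    by (rule omega2_precaliber[OF X(2,1) M HM], assumption, assumption, assumption, rule that)
  have "\<exists>x\<in>topspace K. \<forall>\<alpha>\<in>S. x \<in> H \<alpha>"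
  proof (rule compact_space_common_point[OF assms(4) ne])
    fix F assume "finite F" "F \<subseteq> S"
    from S(3)[OF this] have "{x \<in> space M. \<forall>i\<in>F. x \<in> H i} \<noteq> {}" by (metis emeasure_empty less_irrefl)
    then show "\<exists>x\<in>topspace K. \<forall>\<alpha>\<in>F. x \<in> H \<alpha>" by (auto simp: M_def \<mu>D(1))
  qed (use H(1) S(1) in blast)
  then obtain x where x: "x \<in> topspace K" "\<And>\<alpha>. \<alpha> \<in> S \<Longrightarrow> x \<in> H \<alpha>" by blast
  have "\<forall>U\<in>range (p x). \<exists>\<alpha>. \<alpha> \<in> Field \<omega>\<^sub>2 \<and> d \<alpha> \<in> U"
  proof
    fix U assume U: "U \<in> range (p x)"
    obtain u where u: "u \<in> U" using pop(2)[OF x(1) U] by blast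
    then have "u \<in> K closure_of (d ` Field \<omega>\<^sub>2)" using dense openin_subset[OF pop(1)[OF x(1) U]] by blast
    then show "\<exists>\<alpha>. \<alpha> \<in> Field \<omega>\<^sub>2 \<and> d \<alpha> \<in> U" using pop(1)[OF x(1) U] u unfolding in_closure_of by blast
  qed
  from bchoice[OF this] obtain a where a: "\<And>U. U \<in> range (p x) \<Longrightarrow> a U \<in> Field \<omega>\<^sub>2 \<and> d (a U) \<in> U" by blast
  have "|a ` range (p x)| \<le>o \<omega>\<^sub>1" using card_of_image p(2)[OF x(1)] by (rule ordLeq_transitive)
  moreover have "a ` range (p x) \<subseteq> Field \<omega>\<^sub>2" using a by blast
  ultimately obtain \<beta> where \<beta>: "\<beta> \<in> Field \<omega>\<^sub>2" "a ` range (p x) \<subseteq> underS \<omega>\<^sub>2 \<beta>"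
    using o2.small_set_bounded by blast
  obtain \<alpha> where \<alpha>: "\<alpha> \<in> S" "\<beta> \<in> underS \<omega>\<^sub>2 \<alpha>" using S(2) \<beta>(1) unfolding unbounded_in_def by blast
  have "x \<in> E \<alpha>"
    unfolding E_def in_closure_of
  proof (intro conjI x allI impI)
    fix V assume V: "x \<in> V \<and> openin K V"
    then obtain U where U: "U \<in> range (p x)" "U \<subseteq> V" using psub by blast
    have "a U \<in> underS \<omega>\<^sub>2 \<beta>" using U(1) \<beta>(2) by blast
    then have "a U \<in> underS \<omega>\<^sub>2 \<alpha>" using \<alpha>(2) by (rule underS_trans[OF Card_order_rels(1,2)[OF o2.r(1)]])
    then show "\<exists>y. y \<in> d ` underS \<omega>\<^sub>2 \<alpha> \<and> y \<in> V" using a[OF U(1)] U(2) by blast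
  qed
  moreover have "x \<notin> E \<alpha>" using x(2)[OF \<alpha>(1)] H(2)[of \<alpha>] S(1) \<alpha>(1) by blast
  ultimately show False by contradiction
qed

end
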